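(* Let $n$ and $m$ be integers with $3\le m\le\lfloor n/2\rfloor$, and let $G$ be a bicyclic graph with $n$ vertices and matching number $m$. Then \[ \chi(G)\ge\frac{m+1}{\sqrt{n-m+4}}+\frac{n-2m+1}{\sqrt{n-m+3}}+\frac{m-3}{\sqrt{3}}+1 \] with equality if and only if $G=B_{n,m}$.
   Context: All graphs are simple. For a graph $G$, $d_G(u)$ is the degree of $u$. The sum--connectivity index is $\chi(G)=\sum_{uv\in E(G)}\frac{1}{\sqrt{d_G(u)+d_G(v)}}$. A bicyclic graph is a connected graph with $n$ vertices and $n+1$ edges. The matching number is the maximum number of pairwise vertex-disjoint edges. For $3\le m\le\lfloor n/2\rfloor$, $B_{n,m}$ is the graph obtained by identifying one vertex of each of two triangles (giving a common vertex $c$), then attaching to $c$ exactly $n-2m+1$ pendent vertices (each joined to $c$ by an edge) and $m-3$ paths on two vertices (each path joined to $c$ by an edge from one of its end vertices). *)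

theory Defs
  imports Complex_Main
begin

text \<open>A graph is given by its vertex set \<open>V\<close> and its edge set \<open>E\<close>; an edge is the set of its
  two endpoints.\<close>

definition simple_graph :: "'a set \<Rightarrow> 'a set set \<Rightarrow> bool" where
  "simple_graph V E \<longleftrightarrow> finite V \<and> (\<forall>e\<in>E. e \<subseteq> V \<and> card e = 2)"

definition degree :: "'a set set \<Rightarrow> 'a \<Rightarrow> nat" where
  "degree E u = card {e \<in> E. u \<in> e}"

text \<open>The inner sum is the sum of the degrees of the two endpoints of \<open>e\<close>.\<close>

definition sum_connectivity_index :: "'a set set \<Rightarrow> real" where
  "sum_connectivity_index E = (\<Sum>e\<in>E. 1 / sqrt (real (\<Sum>u\<in>e. degree E u)))"

definition connected_graph :: "'a set \<Rightarrow> 'a set set \<Rightarrow> bool" where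
  "connected_graph V E \<longleftrightarrow> V \<noteq> {} \<and> (\<forall>u\<in>V. \<forall>v\<in>V. (u, v) \<in> {(x, y). {x, y} \<in> E}\<^sup>*)"

definition bicyclic :: "'a set \<Rightarrow> 'a set set \<Rightarrow> bool" where
  "bicyclic V E \<longleftrightarrow> simple_graph V E \<and> connected_graph V E \<and> card E = card V + 1"

definition is_matching :: "'a set set \<Rightarrow> 'a set set \<Rightarrow> bool" where
  "is_matching E M \<longleftrightarrow> M \<subseteq> E \<and> (\<forall>e\<in>M. \<forall>f\<in>M. e \<noteq> f \<longrightarrow> e \<inter> f = {})"

definition matching_number :: "'a set set \<Rightarrow> nat" where
  "matching_number E = Max {card M | M. is_matching E M}"

definition graph_isomorphic :: "'a set \<Rightarrow> 'a set set \<Rightarrow> 'b set \<Rightarrow> 'b set set \<Rightarrow> bool" where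
  "graph_isomorphic V E V' E' \<longleftrightarrow>
     (\<exists>f. bij_betw f V V' \<and> (\<forall>u\<in>V. \<forall>v\<in>V. {u, v} \<in> E \<longleftrightarrow> {f u, f v} \<in> E'))"

text \<open>Vertices of $B_{n,m}$: \<open>Hub\<close> is the common vertex $c$; \<open>Corner t b\<close> (\<open>b\<close> a Boolean) are the two
  other vertices of triangle \<open>t\<close>; \<open>Pendent i\<close> are the pendent vertices attached to $c$; \<open>Near i\<close>
  and \<open>Far i\<close> are the vertices of the \<open>i\<close>-th attached two-vertex path, \<open>Near i\<close> being the end
  joined to $c$.\<close>

datatype B_vertex = Hub | Corner bool bool | Pendent nat | Near nat | Far nat

text \<open>The number $n-2m+1$ of pendent vertices is written \<open>n + 1 - 2 * m\<close> so that natural-number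
  subtraction does not truncate when $n \ge 2m$.\<close>

definition B_vertices :: "nat \<Rightarrow> nat \<Rightarrow> B_vertex set" where
  "B_vertices n m =
     {Hub} \<union> {Corner t b | t b. True} \<union> {Pendent i | i. i < n + 1 - 2 * m} \<union>
     {Near i | i. i < m - 3} \<union> {Far i | i. i < m - 3}"

definition B_edges :: "nat \<Rightarrow> nat \<Rightarrow> B_vertex set set" where
  "B_edges n m =
     {{Hub, Corner t b} | t b. True} \<union> {{Corner t False, Corner t True} | t. True} \<union>
     {{Hub, Pendent i} | i. i < n + 1 - 2 * m} \<union>
     {{Hub, Near i} | i. i < m - 3} \<union> {{Near i, Far i} | i. i < m - 3}"

end

theory Submission
  imports Defs
begin

text \<open>
  Induction on the number of vertices, removing either a pendent path of length two or a pendent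
  vertex whose removal keeps the matching number. Convexity of $1/\sqrt x$ shows that the index
  drops least when the attachment vertex \<open>v\<close> has as many pendent neighbours and as large a degree
  as possible; the matching number allows at most $n-2m+1$ and $n-m+2$ respectively, and for these
  values the drop equals the difference of the two bounds. Equality forces the degree of \<open>v\<close> to be
  $n-m+2$, so \<open>v\<close> is the centre of the smaller extremal graph.

  If neither removal is possible, then every vertex has at most one pendent neighbour, and the graph
  consists of a graph of minimum degree two with \<open>k\<close> vertices and \<open>k + 1\<close> edges together with
  pendent vertices attached to a set of distinct vertices. Its degrees exceed two by a total of two
  only, and replacing the summands by linear lower bounds beats the claimed value, with the single
  exception $B_{6,3}$.
\<close>

section \<open>Analytic estimates\<close>

text \<open>Deleting vertices may push the matching number below three, where no extremal graph
  exists. The induction therefore runs over all matching numbers with the same formula, which is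
  still a valid lower bound for m <= 2 but is never attained there; the equality clause carries
  \<open>3 \<le> m\<close> for this reason.

  Plain convexity settles the dependence of the gain on the number of pendent neighbours, but not on
  the degree: as the degree grows, the new summand shrinks, more edges lose, and each loses less.
  Weighing these effects needs a bound on the ratio of consecutive values of \<open>gap\<close>, and
  \<open>gap_ratio\<close> supplies a rational one, so that only a polynomial inequality remains.

  Irreducible graphs have no further vertex to delete, so they are compared with a line in n
  instead. Its slope 0.41 has to dominate both increments of the bound (1/sqrt 6 = 0.408... for a
  pendent vertex, half of 0.803... for a path) and still stay below what an additional vertex
  contributes to an irreducible graph. The few small graphs for which this margin is missing are
  treated by hand with the true matching number.\<close>

definition inv_sqrt :: "real \<Rightarrow> real" where
  "inv_sqrt x = 1 / sqrt x"

text \<open>The loss of a summand of the index when the degree sum of its edge grows from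
  \<open>x\<close> to \<open>x + 1\<close>.\<close>

definition gap :: "real \<Rightarrow> real" where
  "gap x = inv_sqrt x - inv_sqrt (x + 1)"

text \<open>All subtractions are real, so the formula keeps its meaning for m < 3, where the
  induction also needs it.\<close>

definition extremal :: "nat \<Rightarrow> nat \<Rightarrow> real" where
  "extremal n m = (real m + 1) * inv_sqrt (real n - real m + 4)
      + (real n - 2 * real m + 1) * inv_sqrt (real n - real m + 3)
      + (real m - 3) * inv_sqrt 3 + 1"

text \<open>Deleting an edge at a vertex of degree \<open>d\<close> raises the summand of an edge to a neighbour of
  degree \<open>e\<close> by \<open>gap (d - 1 + e)\<close>, which is at most \<open>gap d\<close> for a pendent neighbour and at most
  \<open>gap (d + 1)\<close> otherwise; \<open>r\<close> counts the remaining pendent neighbours.\<close>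

definition leaf_gain :: "real \<Rightarrow> real \<Rightarrow> real" where
  "leaf_gain d r = inv_sqrt (d + 2) - r * gap d - (d - 1 - r) * gap (d + 1)"

section \<open>Estimates for \<open>inv_sqrt\<close>, \<open>gap\<close> and
  \<open>leaf_gain\<close>\<close>

lemma inv_sqrt_antimono: "0 < x \<Longrightarrow> x \<le> y \<Longrightarrow> inv_sqrt y \<le> inv_sqrt x"
  by (simp add: inv_sqrt_def frac_le)

lemma inv_sqrt_ge: "0 \<le> c \<Longrightarrow> c\<^sup>2 * x \<le> 1 \<Longrightarrow> 0 < x \<Longrightarrow> c \<le> inv_sqrt x"
  unfolding inv_sqrt_def
  by (smt (verit, ccfv_threshold) mult_imp_le_div_pos real_sqrt_abs real_sqrt_gt_0_iff real_sqrt_le_iff real_sqrt_mult real_sqrt_one)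

lemma inv_sqrt_le: "0 \<le> c \<Longrightarrow> 1 \<le> c\<^sup>2 * x \<Longrightarrow> 0 < x \<Longrightarrow> inv_sqrt x \<le> c"
  unfolding inv_sqrt_def
  by (smt (verit, ccfv_threshold) mult_imp_div_pos_le real_sqrt_abs real_sqrt_gt_0_iff real_sqrt_le_iff real_sqrt_mult real_sqrt_one)

lemma inv_sqrt_4: "inv_sqrt 4 = 1/2"
  unfolding inv_sqrt_def by (simp add: real_sqrt_unique)

text \<open>Five decimals are needed: the chords chosen later for cores with two vertices of degree
  three touch some of these lower bounds exactly.\<close>

lemma inv_sqrt_numeric:
  "0.57735 \<le> inv_sqrt 3" "inv_sqrt 3 \<le> 0.57736"
  "0.44721 \<le> inv_sqrt 5" "inv_sqrt 5 \<le> 0.44722"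
  "0.40824 \<le> inv_sqrt 6" "inv_sqrt 6 \<le> 0.40825"
  "0.37796 \<le> inv_sqrt 7" "inv_sqrt 7 \<le> 0.37797"
  "0.35355 \<le> inv_sqrt 8" "inv_sqrt 8 \<le> 0.35356"
  "0.33333 \<le> inv_sqrt 9" "inv_sqrt 9 \<le> 0.33334"
  by (rule inv_sqrt_ge inv_sqrt_le; simp add: power2_eq_square)+

text \<open>Rationalising the difference leaves a denominator that visibly increases in
  \<open>x\<close>, which makes \<open>gap\<close> antitone and its ratios computable.\<close>

lemma gap_eq: "0 < x \<Longrightarrow> gap x = 1 / (sqrt x * sqrt (x + 1) * (sqrt x + sqrt (x + 1)))"
proof -
  assume x: "0 < x"
  have p: "sqrt x > 0" "sqrt (x + 1) > 0" using x by auto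
  have "(sqrt (x+1) - sqrt x) * (sqrt x + sqrt (x + 1)) = 1"
    using x by (simp add: algebra_simps)
  then have "sqrt (x+1) - sqrt x = 1 / (sqrt x + sqrt (x + 1))"
    using p by (metis add_pos_pos eq_divide_eq less_irrefl)
  moreover have "gap x = (sqrt (x+1) - sqrt x) / (sqrt x * sqrt (x + 1))"
    using p by (simp add: gap_def inv_sqrt_def field_simps)
  ultimately show ?thesis by simp
qed

lemma gap_pos: "0 < x \<Longrightarrow> 0 < gap x"
  by (simp add: gap_def inv_sqrt_def frac_less2)

lemma gap_antimono: assumes "0 < x" "x \<le> y" shows "gap y \<le> gap x"
proof -
  have "sqrt x * sqrt (x + 1) * (sqrt x + sqrt (x + 1)) \<le> sqrt y * sqrt (y + 1) * (sqrt y + sqrt (y + 1))"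
    using assms by (intro mult_mono add_mono mult_nonneg_nonneg) auto
  moreover have "0 < sqrt x * sqrt (x + 1) * (sqrt x + sqrt (x + 1))"
    using assms by (auto intro!: mult_pos_pos add_pos_pos)
  ultimately show ?thesis
    using assms by (subst (1 2) gap_eq) (auto intro: divide_left_mono frac_le)
qed

text \<open>Since \<open>gap x\<close> behaves like half of x to the power -3/2, the ratio of
  consecutive gaps is about 1 + 3/(2x), and this is an upper bound. It follows from two instances of
  the inequality of arithmetic and geometric means, for x, x + 2 and for x + 1, x + 2.\<close>

lemma gap_ratio: assumes x: "0 < x" shows "x * gap x \<le> (x + 3/2) * gap (x + 1)"
proof -
  define p q r where "p = sqrt x" and "q = sqrt (x + 1)" and "r = sqrt (x + 2)"
  have pos: "p > 0" "q > 0" "r > 0" using x by (auto simp: p_def q_def r_def)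
  have sq: "p * p = x" "q * q = x + 1" "r * r = x + 2" using x by (auto simp: p_def q_def r_def)
  have "p * r \<le> x + 1"
  proof (rule power2_le_imp_le)
    have "(p * r)\<^sup>2 = (p * p) * (r * r)" by (simp add: power2_eq_square)
    also have "\<dots> = x * (x + 2)" by (simp only: sq)
    finally show "(p * r)\<^sup>2 \<le> (x + 1)\<^sup>2"
      by (simp add: power2_eq_square algebra_simps)
  qed (use x in simp)
  then have 1: "p * (q + r) \<le> q * (p + q)"
    using sq by (simp add: algebra_simps)
  have "q * r \<le> x + 3/2"
  proof (rule power2_le_imp_le)
    have "(q * r)\<^sup>2 = (q * q) * (r * r)" by (simp add: power2_eq_square)
    also have "\<dots> = (x + 1) * (x + 2)" by (simp only: sq)
    finally show "(q * r)\<^sup>2 \<le> (x + 3/2)\<^sup>2"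
      by (simp add: power2_eq_square algebra_simps)
  qed (use x in simp)
  then have 2: "q * r * (p * (q + r)) \<le> (x + 3/2) * (q * (p + q))"
    using 1 pos x by (intro mult_mono[OF _ 1]) auto
  have "p * (q * r * (p * (q + r))) \<le> p * ((x + 3/2) * (q * (p + q)))"
    using 2 pos by (intro mult_left_mono) auto
  then have 3: "x * (q * r * (q + r)) \<le> (x + 3/2) * (p * q * (p + q))"
    unfolding sq(1)[symmetric] by (simp add: mult.assoc mult.left_commute)
  have A: "gap x = 1 / (p * q * (p + q))" "gap (x+1) = 1 / (q * r * (q + r))"
    using x by (simp_all add: gap_eq p_def q_def r_def add.assoc add.commute add.left_commute)
  have "p * q * (p + q) > 0" "q * r * (q + r) > 0" using pos by (auto intro!: mult_pos_pos add_pos_pos)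
  moreover have "x * (1 / P) \<le> y * (1 / Q)" if "0 < P" "0 < Q" "x * Q \<le> y * P" for x y P Q :: real
    using that by (simp add: divide_simps mult.commute)
  ultimately show ?thesis unfolding A using 3 by blast
qed

text \<open>The difference of the two sides is (d+1-r) C - r A - (d-1-2r) B for the consecutive gaps
  A, B, C at d, d+1, d+2. Applying \<open>gap_ratio\<close> twice bounds A by B and B by C, after
  which C is a common factor and a polynomial in d and r decides the sign.\<close>

lemma leaf_gain_step:
  assumes d: "1 \<le> d" and r: "0 \<le> r" "r \<le> d - 1"
  shows "leaf_gain (d + 1) r < leaf_gain d r"
proof -
  define A B C where "A = gap d" and "B = gap (d + 1)" and "C = gap (d + 2)"
  have pos: "0 < B" "0 < C" using d by (auto simp: B_def C_def intro: gap_pos)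
  have AB: "d * A \<le> (d + 3/2) * B" using gap_ratio[of d] d by (simp add: A_def B_def)
  have BC: "(d + 1) * B \<le> (d + 5/2) * C"
    using gap_ratio[of "d+1"] d by (simp add: B_def C_def add.assoc)
  \<comment> \<open>\<open>A\<close> has to go first: d-1-2r may be negative, but once
    \<open>A\<close> is absorbed the coefficient of \<open>B\<close> is nonnegative, so that
    \<open>B\<close> may be estimated by \<open>C\<close>.\<close>
  have "d * (r * A) \<le> r * ((d + 3/2) * B)"
    using mult_left_mono[OF AB r(1)] by (simp add: mult.left_commute)
  then have 1: "d * (r * A + (d - 1 - 2*r) * B) \<le> (d * (d - 1 - r) + 3/2 * r) * B"
    by (simp add: algebra_simps)
  have k: "0 \<le> d * (d - 1 - r) + 3/2 * r" using d r by simp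
  have 2: "(d + 1) * ((d * (d - 1 - r) + 3/2 * r) * B) \<le> (d * (d - 1 - r) + 3/2 * r) * ((d + 5/2) * C)"
    using mult_left_mono[OF BC k] by (simp add: mult.left_commute)
  \<comment> \<open>What is left of the polynomial inequality is 15/4 r < (d/2 + 7/2) d; it holds
    because r < d and d/2 + 7/2 is at least 4.\<close>
  have "15/4 * r \<le> 15/4 * d" using r by simp
  also have "\<dots> < (d/2 + 7/2) * d"
  proof -
    have "15/4 < d/2 + 7/2" using d by simp
    then show ?thesis using d by (intro mult_strict_right_mono) auto
  qed
  finally have "15/4 * r < (d/2 + 7/2) * d" .
  moreover have "d * (d + 1 - r) * (d + 1) - (d * (d - 1 - r) + 3/2 * r) * (d + 5/2)
      = (d/2 + 7/2) * d - 15/4 * r"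
    by (simp add: field_simps)
  ultimately have "(d * (d - 1 - r) + 3/2 * r) * (d + 5/2) < d * (d + 1 - r) * (d + 1)"
    by linarith
  then have 3: "(d * (d - 1 - r) + 3/2 * r) * ((d + 5/2) * C) < (d + 1) * (d * ((d + 1 - r) * C))"
    using mult_strict_right_mono[OF _ pos(2)] by (fastforce simp: mult_ac)
  have "(d + 1) * (d * (r * A + (d - 1 - 2*r) * B)) \<le> (d + 1) * ((d * (d - 1 - r) + 3/2 * r) * B)"
    using 1 d by (intro mult_left_mono) auto
  with 2 3 have "(d + 1) * (d * (r * A + (d - 1 - 2*r) * B)) < (d + 1) * (d * ((d + 1 - r) * C))"
    by linarith
  then have "r * A + (d - 1 - 2*r) * B < (d + 1 - r) * C"
    using d by (simp add: mult_less_cancel_left)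
  moreover have "inv_sqrt (d + 3) = inv_sqrt (d + 2) - C"
    by (simp add: C_def gap_def add.assoc)
  ultimately show ?thesis
    by (simp add: leaf_gain_def A_def B_def C_def algebra_simps)
qed

lemma leaf_gain_antimono_snd:
  assumes "0 < d" "r \<le> R" shows "leaf_gain d R \<le> leaf_gain d r"
proof -
  have "0 \<le> (R - r) * (gap d - gap (d + 1))"
    using gap_antimono[of d "d+1"] assms by simp
  then show ?thesis by (simp add: leaf_gain_def algebra_simps)
qed

text \<open>For positive \<open>k\<close> the right-hand side is just
  \<open>leaf_gain (d + 1) r\<close>. Keeping the first, strict drop in the statement lets both the
  weak and the strict comparison be read off afterwards.\<close>

lemma leaf_gain_antimono_fst:
  assumes "1 \<le> d" "0 \<le> r" "r \<le> d - 1"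
  shows "leaf_gain (d + real k) r \<le> leaf_gain d r - (if k = 0 then 0 else leaf_gain d r - leaf_gain (d + 1) r)"
proof (induction k)
  case (Suc k)
  have "leaf_gain (d + real k + 1) r < leaf_gain (d + real k) r"
    using assms by (intro leaf_gain_step) auto
  with Suc leaf_gain_step[OF assms] show ?case by (auto split: if_splits simp: add_ac)
qed simp

lemma leaf_gain_le:
  fixes d r D R :: nat
  assumes "1 \<le> d" "r + 1 \<le> d" "r \<le> R" "d \<le> D"
  shows "leaf_gain (real D) (real R) \<le> leaf_gain (real d) (real r)"
    and "d \<noteq> D \<Longrightarrow> leaf_gain (real D) (real R) < leaf_gain (real d) (real r)"
proof -
  \<comment> \<open>The count is lowered at the large degree \<open>D\<close> and the degree only
    then: monotonicity in the degree requires the count to be at most d-1, which is known for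
    \<open>r\<close> but not for \<open>R\<close>.\<close>
  have 1: "leaf_gain (real D) (real R) \<le> leaf_gain (real D) (real r)"
    using assms by (intro leaf_gain_antimono_snd) auto
  have 2: "leaf_gain (real D) (real r) \<le> leaf_gain d r - (if D - d = 0 then 0 else leaf_gain d r - leaf_gain (real d + 1) r)"
    using leaf_gain_antimono_fst[of d r "D - d"] assms by (auto simp: of_nat_diff)
  have 3: "leaf_gain (real d + 1) r < leaf_gain d r" using assms by (intro leaf_gain_step) auto
  show "leaf_gain (real D) (real R) \<le> leaf_gain (real d) (real r)"
    using 1 2 3 by (auto split: if_splits)
  show "leaf_gain (real D) (real R) < leaf_gain (real d) (real r)" if "d \<noteq> D"
    using 1 2 3 that assms by (auto split: if_splits)
qed

text \<open>This is the gain of a pendent vertex at the largest degree n-m+3 and the largest number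
  n+1-2m of further pendent neighbours that a bicyclic graph with n+1 vertices and matching number m
  allows. Equality here is what makes the pendent reduction sharp.\<close>

lemma extremal_step1:
  assumes "2 * m \<le> n"
  shows "extremal (n + 1) m - extremal n m =
    leaf_gain (real (n - m + 3)) (real (n + 1 - 2 * m)) + gap (real (n - m + 4))"
proof -
  define x where "x = real n - real m"
  have e: "real (n - m) = x" "real (n + 1 - 2*m) = real n + 1 - 2 * real m"
    using assms by (auto simp: x_def of_nat_diff)
  have n: "real n = x + real m" by (simp add: x_def)
  show ?thesis
    unfolding extremal_def leaf_gain_def gap_def e of_nat_add
    by (simp add: n add_ac) (simp add: algebra_simps)
qed

text \<open>The counterpart for a removed path: \<open>inv_sqrt 3\<close> is its outer edge, with
  degrees 1 and 2. The term \<open>gap\<close> of the pendent case is absent because the inner edge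
  loses it when its outer end gets degree two.\<close>

lemma extremal_step2:
  assumes "2 * m \<le> n"
  shows "extremal (n + 2) (m + 1) - extremal n m =
    inv_sqrt 3 + leaf_gain (real (n - m + 3)) (real (n + 1 - 2 * m))"
proof -
  define x where "x = real n - real m"
  have e: "real (n - m) = x" "real (n + 1 - 2*m) = real n + 1 - 2 * real m"
    using assms by (auto simp: x_def of_nat_diff)
  have n: "real n = x + real m" by (simp add: x_def)
  show ?thesis
    unfolding extremal_def leaf_gain_def gap_def e of_nat_add
    by (simp add: n add_ac) (simp add: algebra_simps)
qed

text \<open>A new pendent edge raises the bound by at most its own summand
  \<open>inv_sqrt (D + 1)\<close>, the other terms being losses. As \<open>D\<close> is at least 5,
  this is at most 1/sqrt 6 < 0.41.\<close>

lemma extremal_step1_le: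
  assumes "2 * m \<le> n" "4 \<le> n"
  shows "extremal (n + 1) m \<le> extremal n m + 0.41"
proof -
  define D R where "D = real (n - m + 3)" and "R = real (n + 1 - 2 * m)"
  have DR: "D \<ge> 5" "0 \<le> R" "0 \<le> D - 1 - R" using assms by (auto simp: D_def R_def)
  have "0 \<le> R * gap D" "0 \<le> (D - 1 - R) * gap (D + 1)"
    using DR gap_pos[of D] gap_pos[of "D+1"] by auto
  then have "leaf_gain D R + gap (D + 1) \<le> inv_sqrt (D + 1)"
    by (simp add: leaf_gain_def gap_def algebra_simps)
  also have "\<dots> \<le> inv_sqrt 6" using DR by (intro inv_sqrt_antimono) auto
  finally show ?thesis
    using extremal_step1[OF assms(1)] inv_sqrt_numeric by (simp add: D_def R_def add_ac)
qed

text \<open>Along n = 2m the increment is \<open>inv_sqrt 3 + leaf_gain (m + 3) 1\<close>, largest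
  at m = 3 by monotonicity of the gain. The factor 0.82 is twice the slope 0.41 because n grows by
  two.\<close>

lemma extremal_even:
  assumes "3 \<le> m" shows "extremal (2 * m) m \<le> extremal 6 3 + 0.82 * (real m - 3)"
  using assms
proof (induction m rule: dec_induct)
  case (step m)
  have "extremal (2 * Suc m) (Suc m) - extremal (2 * m) m = inv_sqrt 3 + leaf_gain (real (m + 3)) 1"
    using extremal_step2[of m "2*m"] by (simp add: mult_2)
  also have "\<dots> \<le> inv_sqrt 3 + leaf_gain 6 1"
    using leaf_gain_le(1)[of 6 1 1 "m+3"] step by simp
  also have "\<dots> \<le> 0.82"
    using inv_sqrt_numeric by (simp add: leaf_gain_def gap_def)
  finally have "extremal (2 * Suc m) (Suc m) \<le> extremal (2 * m) m + 0.82" by linarith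
  with step.IH show ?case by (simp add: field_simps)
qed simp

text \<open>The slope \<open>0.41\<close> is just above half the increment of \<open>extremal\<close> from $(6,3)$ to $(8,4)$; the line
  is exact at $(6,3)$, the only case with equality among the irreducible graphs.\<close>

lemma extremal_linear:
  assumes "2 * m \<le> n" "4 \<le> n"
  shows "extremal n m \<le> extremal 6 3 + 0.41 * (real n - 6)"
proof -
  \<comment> \<open>The start is not simply 2m: for m <= 1 that would be too small for
    \<open>extremal_step1_le\<close>, which needs n >= 4.\<close>
  have "max 4 (2 * m) \<le> n" using assms by simp
  then show ?thesis
  proof (induction n rule: dec_induct)
    case base
    consider "m = 0" | "m = 1" | "m = 2" | "m \<ge> 3" by linarith
    then show ?case
    proof cases
      case 4
      then have "max 4 (2 * m) = 2 * m" by simp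
      then show ?thesis using extremal_even[OF 4] by (simp add: field_simps)
    qed (use inv_sqrt_numeric in \<open>simp_all add: extremal_def\<close>)
  next
    case (step n)
    then show ?case using extremal_step1_le[of m n] by (simp add: field_simps)
  qed
qed

text \<open>For six vertices the line only gives \<open>extremal 6 3\<close>, about 2.92, while one
  irreducible graph is guaranteed no more than 2.8. Its matching number is at most two, and there
  the bound itself is much smaller.\<close>

lemma extremal_6: "m \<le> 2 \<Longrightarrow> extremal 6 m \<le> 2.7"
proof -
  assume "m \<le> 2"
  then consider "m = 0" | "m = 1" | "m = 2" by linarith
  then show ?thesis
    using inv_sqrt_numeric inv_sqrt_antimono[of 9 10] by cases (auto simp: extremal_def)
qed

lemma extremal_6_3: "2.92 \<le> extremal 6 3" "extremal 6 3 \<le> 2.921" "extremal 6 3 = 4 * inv_sqrt 7 + inv_sqrt 6 + 1"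
  using inv_sqrt_numeric by (auto simp: extremal_def)

text \<open>Serves the irreducible graphs with seven vertices whose guaranteed index 3.3 lies below
  the line. An odd number of vertices leaves one vertex unmatched, so m is at most three.\<close>

lemma extremal_7: "m \<le> 3 \<Longrightarrow> extremal 7 m \<le> 3.2"
proof -
  assume "m \<le> 3"
  then consider "m = 0" | "m = 1" | "m = 2" | "m = 3" by linarith
  then show ?thesis
    using inv_sqrt_numeric inv_sqrt_antimono[of 9 10]  inv_sqrt_antimono[of 9 11] by cases (auto simp: extremal_def)
qed

section \<open>Leaves and matchings\<close>

definition nbrs :: "'a set set \<Rightarrow> 'a \<Rightarrow> 'a set" where
  "nbrs E v = {w. {v, w} \<in> E}"

definition del :: "'a set set \<Rightarrow> 'a \<Rightarrow> 'a set set" where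
  "del E u = {e \<in> E. u \<notin> e}"

lemma simple_graph_finite: "simple_graph V E \<Longrightarrow> finite V \<and> finite E"
proof -
  assume "simple_graph V E"
  then have "finite V" "E \<subseteq> Pow V" by (auto simp: simple_graph_def)
  then show ?thesis by (meson finite_Pow_iff finite_subset)
qed

lemma simple_graph_edgeE:
  assumes "simple_graph V E" "e \<in> E" "v \<in> e"
  obtains w where "w \<noteq> v" "e = {v, w}" "w \<in> V" "v \<in> V"
proof -
  from assms have "card e = 2" "e \<subseteq> V" by (auto simp: simple_graph_def)
  then obtain x y where "e = {x, y}" "x \<noteq> y" by (auto simp: card_2_iff)
  with assms(3) consider "v = x" | "v = y" by auto
  then show thesis
  proof cases
    case 1
    with \<open>e = {x, y}\<close> \<open>x \<noteq> y\<close> \<open>e \<subseteq> V\<close> show thesis by (intro that[of y]) auto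
  next
    case 2
    with \<open>e = {x, y}\<close> \<open>x \<noteq> y\<close> \<open>e \<subseteq> V\<close> show thesis by (intro that[of x]) auto
  qed
qed

lemma nbrs_sym: "w \<in> nbrs E v \<longleftrightarrow> v \<in> nbrs E w"
  by (simp add: nbrs_def insert_commute)

lemma simple_graph_nbrs:
  assumes "simple_graph V E"
  shows "nbrs E v \<subseteq> V" "v \<notin> nbrs E v" "finite (nbrs E v)" "w \<in> nbrs E v \<Longrightarrow> v \<in> V"
proof -
  show 1: "nbrs E v \<subseteq> V"
    using assms by (auto simp: nbrs_def simple_graph_def)
  show "v \<notin> nbrs E v"
    using assms by (auto simp: nbrs_def simple_graph_def)
  show "finite (nbrs E v)"
    using 1 simple_graph_finite[OF assms] finite_subset by blast
  show "w \<in> nbrs E v \<Longrightarrow> v \<in> V"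
    using assms by (auto simp: nbrs_def simple_graph_def)
qed

lemma incident_eq:
  assumes "simple_graph V E"
  shows "{e \<in> E. v \<in> e} = (\<lambda>w. {v, w}) ` nbrs E v"
proof (rule set_eqI, rule iffI)
  fix e assume e: "e \<in> {e \<in> E. v \<in> e}"
  then obtain w where "e = {v, w}" using simple_graph_edgeE[OF assms, of e v] by blast
  with e show "e \<in> (\<lambda>w. {v, w}) ` nbrs E v" by (simp add: nbrs_def)
qed (auto simp: nbrs_def)

lemma inj_pair: "inj_on (\<lambda>w. {v, w}) A"
  by (auto simp: inj_on_def doubleton_eq_iff)

lemma degree_nbrs:
  assumes "simple_graph V E"
  shows "degree E v = card (nbrs E v)"
  unfolding degree_def incident_eq[OF assms] by (rule card_image[OF inj_pair])

lemma sum_incident: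
  assumes "simple_graph V E"
  shows "(\<Sum>e\<in>{e \<in> E. v \<in> e}. g e) = (\<Sum>w\<in>nbrs E v. g {v, w})"
  unfolding incident_eq[OF assms] by (subst sum.reindex[OF inj_pair]) simp

text \<open>Double counting of incidences with a weight on the vertices. The weights used later mark
  pendent attachments and degree excess, so that linear bounds on the edges depend on degrees
  only.\<close>

lemma handshake:
  fixes g :: "'a \<Rightarrow> real"
  assumes "simple_graph V E"
  shows "(\<Sum>e\<in>E. \<Sum>v\<in>e. g v) = (\<Sum>v\<in>V. real (degree E v) * g v)"
proof -
  note fin = simple_graph_finite[OF assms]
  have sub: "e \<subseteq> V" if "e \<in> E" for e using assms that by (auto simp: simple_graph_def)
  have "(\<Sum>e\<in>E. \<Sum>v\<in>e. g v) = (\<Sum>e\<in>E. \<Sum>v\<in>V. if v \<in> e then g v else 0)"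
  proof (rule sum.cong[OF refl])
    fix e assume "e \<in> E"
    then show "sum g e = (\<Sum>v\<in>V. if v \<in> e then g v else 0)"
      using fin sub[of e] by (simp add: sum.inter_restrict[symmetric] Int_absorb1)
  qed
  also have "\<dots> = (\<Sum>v\<in>V. \<Sum>e\<in>E. if v \<in> e then g v else 0)"
    by (rule sum.swap)
  also have "\<dots> = (\<Sum>v\<in>V. real (degree E v) * g v)"
    using fin by (simp add: sum.If_cases degree_def Int_def)
  finally show ?thesis .
qed

lemma handshake_card:
  assumes "simple_graph V E"
  shows "(\<Sum>v\<in>V. real (degree E v)) = 2 * real (card E)"
proof -
  have "(\<Sum>e\<in>E. \<Sum>v\<in>e. (1::real)) = (\<Sum>e\<in>E. 2)"
    using assms by (intro sum.cong refl) (auto simp: simple_graph_def)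
  with handshake[OF assms, of "\<lambda>_. 1"] show ?thesis by simp
qed

lemma simple_graph_del: "simple_graph V E \<Longrightarrow> simple_graph (V - {u}) (del E u)"
  by (auto simp: simple_graph_def del_def)

lemma nbrs_del: "w \<noteq> u \<Longrightarrow> nbrs (del E u) w = nbrs E w - {u}"
  by (auto simp: nbrs_def del_def)

lemma sum_edges_split:
  fixes g :: "'a set \<Rightarrow> real"
  assumes "simple_graph V E"
  shows "(\<Sum>e\<in>E. g e) = (\<Sum>e\<in>del E c. g e) + (\<Sum>w\<in>nbrs E c. g {c, w})"
proof -
  have "(\<Sum>e\<in>E. g e) = (\<Sum>e\<in>del E c \<union> {e \<in> E. c \<in> e}. g e)"
    by (rule sum.cong) (auto simp: del_def)
  also have "\<dots> = (\<Sum>e\<in>del E c. g e) + (\<Sum>e\<in>{e \<in> E. c \<in> e}. g e)"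
    using simple_graph_finite[OF assms] by (intro sum.union_disjoint) (auto simp: del_def)
  finally show ?thesis using sum_incident[OF assms] by simp
qed

lemma card_del:
  assumes "simple_graph V E"
  shows "card E = card (del E u) + degree E u"
proof -
  have "E = del E u \<union> {e \<in> E. u \<in> e}" by (auto simp: del_def)
  moreover have "card (del E u \<union> {e \<in> E. u \<in> e}) = card (del E u) + degree E u"
    unfolding degree_def using simple_graph_finite[OF assms]
    by (intro card_Un_disjoint) (auto simp: del_def)
  ultimately show ?thesis by simp
qed

lemma degree_del:
  assumes "simple_graph V E" "w \<noteq> u"
  shows "degree E w = degree (del E u) w + (if u \<in> nbrs E w then 1 else 0)"
proof -
  have "degree (del E u) w = card (nbrs E w - {u})"
    using degree_nbrs[OF simple_graph_del[OF assms(1), of u], of w] nbrs_del[OF assms(2), of E] by simp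
  moreover have "card (nbrs E w) = card (nbrs E w - {u}) + (if u \<in> nbrs E w then 1 else 0)"
  proof (cases "u \<in> nbrs E w")
    case True
    then show ?thesis by (subst card.remove[OF simple_graph_nbrs(3)[OF assms(1)] True]) simp
  qed simp
  ultimately show ?thesis using degree_nbrs[OF assms(1), of w] by linarith
qed

lemma leaf_nbrs:
  assumes "simple_graph V E" "degree E u = 1" "{u, v} \<in> E"
  shows "nbrs E u = {v}"
proof -
  have "card (nbrs E u) = 1" using degree_nbrs[OF assms(1), of u] assms(2) by simp
  moreover have "v \<in> nbrs E u" using assms(3) by (simp add: nbrs_def)
  ultimately show ?thesis by (auto simp: card_1_singleton_iff)
qed

lemma leaf_edge:
  assumes "simple_graph V E" "degree E u = 1" "{u, v} \<in> E" "e \<in> E" "u \<in> e"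
  shows "e = {u, v}"
proof -
  obtain w where "e = {u, w}" using simple_graph_edgeE[OF assms(1,4,5)] by metis
  moreover from this have "w \<in> nbrs E u" using assms(4) by (simp add: nbrs_def)
  ultimately show ?thesis using leaf_nbrs[OF assms(1-3)] by auto
qed

lemma leafE:
  assumes "simple_graph V E" "degree E u = 1"
  obtains v where "{u, v} \<in> E" "v \<noteq> u" "u \<in> V" "v \<in> V"
proof -
  have "card (nbrs E u) = 1" using assms degree_nbrs by metis
  then obtain v where "v \<in> nbrs E u" by (auto simp: card_1_singleton_iff)
  then have "{u, v} \<in> E" by (simp add: nbrs_def)
  moreover have "v \<in> V" "v \<noteq> u" "u \<in> V"
    using simple_graph_nbrs[OF assms(1)] \<open>v \<in> nbrs E u\<close> by blast+
  ultimately show thesis using that by blast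
qed

section \<open>Change of the index when a pendent vertex is deleted\<close>

lemma index_eq: "sum_connectivity_index E = (\<Sum>e\<in>E. inv_sqrt (\<Sum>v\<in>e. real (degree E v)))"
  by (simp add: sum_connectivity_index_def inv_sqrt_def)

lemma index_leaf:
  assumes sg: "simple_graph V E" and u: "degree E u = 1" and uv: "{u, v} \<in> E"
  defines "d \<equiv> real (degree E v)"
  shows "sum_connectivity_index E = sum_connectivity_index (del E u) + inv_sqrt (d + 1) +
    (\<Sum>w\<in>nbrs E v - {u}. inv_sqrt (d + real (degree E w)) - inv_sqrt (d - 1 + real (degree E w)))"
proof -
  note fin = simple_graph_finite[OF sg] and sg' = simple_graph_del[OF sg, of u]
  have fin': "finite (del E u)" using simple_graph_finite[OF sg'] by blast
  have vu: "v \<noteq> u" using sg uv by (auto simp: simple_graph_def)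
  let ?F = "\<lambda>e. inv_sqrt (\<Sum>v\<in>e. real (degree E v))"
  let ?F' = "\<lambda>e. inv_sqrt (\<Sum>v\<in>e. real (degree (del E u) v))"
  have nb: "u \<in> nbrs E w \<longleftrightarrow> w = v" for w
    using leaf_nbrs[OF sg u uv] nbrs_sym[of u E w] by auto
  have deg: "degree (del E u) w = (if w = v then degree E v - 1 else degree E w)" if "w \<noteq> u" for w
    using degree_del[OF sg that] by (cases "w = v") (simp_all add: nb)
  have dv: "degree E v \<ge> 1" using degree_del[OF sg vu] by (simp add: nb)
  have notin: "{u, v} \<notin> del E u" by (simp add: del_def)
  have "E = insert {u, v} (del E u)"
  proof (intro equalityI subsetI)
    fix e assume "e \<in> E"
    then show "e \<in> insert {u, v} (del E u)"
      using leaf_edge[OF sg u uv, of e] by (cases "u \<in> e") (simp_all add: del_def)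
  qed (use uv in \<open>auto simp: del_def\<close>)
  then have "(\<Sum>e\<in>E. ?F e) = (\<Sum>e\<in>insert {u, v} (del E u). ?F e)"
    by (rule arg_cong)
  also have "\<dots> = ?F {u, v} + (\<Sum>e\<in>del E u. ?F e)"
    using fin' notin by (rule sum.insert)
  also have "?F {u, v} = inv_sqrt (d + 1)"
    using u vu by (simp add: d_def add.commute)
  also have "(\<Sum>e\<in>del E u. ?F e) = (\<Sum>e\<in>del E u. ?F' e) + (\<Sum>e\<in>del E u. ?F e - ?F' e)"
    by (simp add: sum_subtractf)
  \<comment> \<open>Among the surviving vertices only \<open>v\<close> changes its degree, so edges
    avoiding \<open>v\<close> contribute nothing.\<close>
  also have "(\<Sum>e\<in>del E u. ?F e - ?F' e) = (\<Sum>e\<in>{e \<in> del E u. v \<in> e}. ?F e - ?F' e)"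
  proof (rule sum.mono_neutral_right)
    show "\<forall>e\<in>del E u - {e \<in> del E u. v \<in> e}. ?F e - ?F' e = 0"
    proof
      fix e assume e: "e \<in> del E u - {e \<in> del E u. v \<in> e}"
      have "(\<Sum>v\<in>e. real (degree E v)) = (\<Sum>v\<in>e. real (degree (del E u) v))"
      proof (intro sum.cong refl)
        fix x assume "x \<in> e"
        with e have "x \<noteq> u" "x \<noteq> v" by (auto simp: del_def)
        then show "real (degree E x) = real (degree (del E u) x)" using deg[of x] by simp
      qed
      then show "?F e - ?F' e = 0" by simp
    qed
  qed (use fin' in auto)
  also have "\<dots> = (\<Sum>w\<in>nbrs (del E u) v. ?F {v, w} - ?F' {v, w})"
    by (rule sum_incident[OF sg'])
  also have "nbrs (del E u) v = nbrs E v - {u}" using vu by (rule nbrs_del)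
  also have "(\<Sum>w\<in>nbrs E v - {u}. ?F {v, w} - ?F' {v, w}) =
      (\<Sum>w\<in>nbrs E v - {u}. inv_sqrt (d + real (degree E w)) - inv_sqrt (d - 1 + real (degree E w)))"
  proof (intro sum.cong refl)
    fix w assume "w \<in> nbrs E v - {u}"
    then have "w \<noteq> u" "v \<noteq> w" using simple_graph_nbrs(2)[OF sg, of v] by auto
    then show "?F {v, w} - ?F' {v, w} = inv_sqrt (d + real (degree E w)) - inv_sqrt (d - 1 + real (degree E w))"
      using deg[of w] deg[of v] vu dv by (simp add: d_def of_nat_diff)
  qed
  finally show ?thesis by (simp add: index_eq)
qed

lemma degree_pos_nbr:
  assumes "simple_graph V E" "w \<in> nbrs E v" shows "1 \<le> degree E v"
proof -
  have "0 < card (nbrs E v)"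
    using simple_graph_nbrs(3)[OF assms(1), of v] assms(2) by (auto simp: card_gt_0_iff)
  then show ?thesis using degree_nbrs[OF assms(1), of v] by simp
qed

lemma index_leaf_ge:
  assumes sg: "simple_graph V E" and u: "degree E u = 1" and uv: "{u, v} \<in> E"
  defines "d \<equiv> real (degree E v)"
  defines "r \<equiv> real (card {w \<in> nbrs E v - {u}. degree E w = 1})"
  shows "sum_connectivity_index E \<ge> sum_connectivity_index (del E u) + leaf_gain d r + gap (d + 1)"
proof -
  let ?N = "nbrs E v - {u}"
  have fin: "finite ?N" using simple_graph_nbrs(3)[OF sg] by simp
  have uN: "u \<in> nbrs E v" using uv by (simp add: nbrs_def insert_commute)
  then have d1: "degree E v \<ge> 1" using sg by (rule degree_pos_nbr[rotated])
  have cN: "real (card ?N) = d - 1"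
    using uN degree_nbrs[OF sg, of v] d1 by (simp add: d_def of_nat_diff)
  have "- (if degree E w = 1 then gap d else gap (d + 1)) \<le> inv_sqrt (d + real (degree E w)) - inv_sqrt (d - 1 + real (degree E w))"
    if "w \<in> ?N" for w
  proof -
    have "degree E w \<ge> 1"
      using that nbrs_sym[of w E v] degree_pos_nbr[OF sg, of v w] by blast
    moreover have "gap (d - 1 + real (degree E w)) \<le> gap (d + 1)" if "degree E w \<ge> 2"
      using that d1 by (intro gap_antimono) (auto simp: d_def)
    ultimately show ?thesis
      using d1 by (cases "degree E w = 1") (auto simp: gap_def d_def add_ac)
  qed
  then have "(\<Sum>w\<in>?N. - (if degree E w = 1 then gap d else gap (d + 1))) \<le>
      (\<Sum>w\<in>?N. inv_sqrt (d + real (degree E w)) - inv_sqrt (d - 1 + real (degree E w)))"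
    by (rule sum_mono)
  moreover have "(\<Sum>w\<in>?N. - (if degree E w = 1 then gap d else gap (d + 1))) = - (r * gap d + (d - 1 - r) * gap (d + 1))"
  proof -
    have "card ?N = card {w \<in> ?N. degree E w = 1} + card {w \<in> ?N. degree E w \<noteq> 1}"
      using fin by (subst card_Un_disjoint[symmetric]) (auto intro!: arg_cong[where f = card])
    then have "real (card {w \<in> ?N. degree E w \<noteq> 1}) = d - 1 - r"
      using cN unfolding r_def by linarith
    then show ?thesis
      using fin by (simp add: sum_negf sum.If_cases r_def Int_def)
  qed
  \<comment> \<open>The summand of the deleted edge is split so that both reductions share the same
    \<open>leaf_gain\<close>: the extra \<open>gap (d + 1)\<close> stays for a pendent vertex and
    cancels for a path.\<close>
  moreover have "inv_sqrt (d + 1) = inv_sqrt (d + 2) + gap (d + 1)" by (simp add: gap_def add_ac)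
  ultimately show ?thesis
    using index_leaf[OF sg u uv] by (simp add: leaf_gain_def d_def add.commute)
qed

section \<open>Matching number: degree restrictions and behaviour under deletion\<close>

lemma matching_finite:
  assumes "finite E" shows "finite {card M | M. is_matching E M}" "{card M | M. is_matching E M} \<noteq> {}"
proof -
  have "{M. is_matching E M} \<subseteq> Pow E" by (auto simp: is_matching_def)
  then have "finite {M. is_matching E M}" by (rule finite_subset) (simp add: assms)
  then show "finite {card M | M. is_matching E M}" by simp
  have "is_matching E {}" by (simp add: is_matching_def)
  then show "{card M | M. is_matching E M} \<noteq> {}" by auto
qed

lemma matching_card_le:
  assumes "finite E" "is_matching E M" shows "card M \<le> matching_number E"
  unfolding matching_number_def using matching_finite[OF assms(1)] assms(2) by (intro Max_ge) auto

lemma max_matchingE: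
  assumes "finite E"
  obtains M where "is_matching E M" "card M = matching_number E" "finite M"
proof -
  have "matching_number E \<in> {card M | M. is_matching E M}"
    unfolding matching_number_def using matching_finite[OF assms] by (intro Max_in)
  then obtain M where "is_matching E M" "card M = matching_number E" by auto
  moreover from this have "finite M" by (auto simp: is_matching_def intro: finite_subset[OF _ assms])
  ultimately show thesis by (rule that)
qed

lemma matching_unique:
  assumes "is_matching E M" "e \<in> M" "e' \<in> M" "v \<in> e" "v \<in> e'"
  shows "e = e'"
proof (rule ccontr)
  assume "e \<noteq> e'"
  with assms(1-3) have "e \<inter> e' = {}" by (simp add: is_matching_def)
  with assms(4,5) show False by blast
qed

lemma matching_edge: "is_matching E M \<Longrightarrow> e \<in> M \<Longrightarrow> e \<in> E"
  by (auto simp: is_matching_def)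

lemma matching_incident:
  assumes "is_matching E M" shows "card {e \<in> M. v \<in> e} \<le> 1"
proof -
  have "\<forall>e\<in>{e \<in> M. v \<in> e}. \<forall>e'\<in>{e \<in> M. v \<in> e}. e = e'"
    by (intro ballI) (rule matching_unique[OF assms, where v = v]; simp)
  with card_le_Suc0_iff_eq[of "{e \<in> M. v \<in> e}"]
  have "finite {e \<in> M. v \<in> e} \<Longrightarrow> card {e \<in> M. v \<in> e} \<le> Suc 0" by (rule iffD2)
  \<comment> \<open>An infinite set has cardinality 0, which covers the case where the counting
    lemma does not apply.\<close>
  then show ?thesis
    using card.infinite[of "{e \<in> M. v \<in> e}"] by fastforce
qed

lemma matching_number_del_le:
  assumes "finite E" shows "matching_number (del E u) \<le> matching_number E"
proof -
  have "finite (del E u)" using assms by (simp add: del_def)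
  then obtain M where M: "is_matching (del E u) M" "card M = matching_number (del E u)"
    by (rule max_matchingE)
  then have "is_matching E M" by (auto simp: is_matching_def del_def)
  from matching_card_le[OF assms this] M(2) show ?thesis by simp
qed

lemma matching_avoid:
  assumes "is_matching E M" "finite M"
  shows "card M \<le> card {e \<in> M. v \<notin> e} + 1"
proof -
  have "M = {e \<in> M. v \<notin> e} \<union> {e \<in> M. v \<in> e}" by auto
  then have "card M = card ({e \<in> M. v \<notin> e} \<union> {e \<in> M. v \<in> e})" by (rule arg_cong)
  also have "\<dots> \<le> card {e \<in> M. v \<notin> e} + card {e \<in> M. v \<in> e}" by (rule card_Un_le)
  finally have "card M \<le> card {e \<in> M. v \<notin> e} + card {e \<in> M. v \<in> e}" .
  with matching_incident[OF assms(1), of v] show ?thesis by simp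
qed

text \<open>The edges at \<open>v\<close> are disjoint from the matching edges avoiding
  \<open>v\<close>, and at most one matching edge meets \<open>v\<close>. In a bicyclic graph this
  bounds every degree by n-m+2, the degree of the centre of the extremal graph.\<close>

lemma degree_matching_le:
  assumes "simple_graph V E"
  shows "degree E v + matching_number E \<le> card E + 1"
proof -
  have fin: "finite E" using simple_graph_finite[OF assms] by blast
  obtain M where M: "is_matching E M" "card M = matching_number E" "finite M"
    using max_matchingE[OF fin] .
  have "card {e \<in> E. v \<in> e} + card {e \<in> M. v \<notin> e} = card ({e \<in> E. v \<in> e} \<union> {e \<in> M. v \<notin> e})"
    using fin M(3) by (intro card_Un_disjoint[symmetric]) auto
  also have "\<dots> \<le> card E"
    using fin M(1) by (intro card_mono) (auto simp: is_matching_def)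
  finally show ?thesis using matching_avoid[OF M(1,3), of v] M(2) by (simp add: degree_def)
qed

text \<open>The same count for two vertices: their edge sets share at most the edge joining them,
  and at most two matching edges meet them.\<close>

lemma edge_matching_le:
  assumes "simple_graph V E" "x \<noteq> y"
  shows "degree E x + degree E y + matching_number E \<le> card E + 3"
proof -
  have fin: "finite E" using simple_graph_finite[OF assms(1)] by blast
  obtain M where M: "is_matching E M" "card M = matching_number E" "finite M"
    using max_matchingE[OF fin] .
  let ?X = "{e \<in> E. x \<in> e}" and ?Y = "{e \<in> E. y \<in> e}" and ?M = "{e \<in> {e \<in> M. x \<notin> e}. y \<notin> e}"
  have "is_matching E {e \<in> M. x \<notin> e}" using M(1) by (auto simp: is_matching_def)
  then have 1: "card M \<le> card ?M + 2"
    using matching_avoid[OF M(1,3), of x] matching_avoid[of E "{e \<in> M. x \<notin> e}" y] M(3) by simp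
  have "e = {x, y}" if e: "e \<in> ?X \<inter> ?Y" for e
  proof -
    obtain w where "e = {x, w}" using simple_graph_edgeE[OF assms(1), of e x] e by blast
    with e assms(2) show ?thesis by auto
  qed
  then have "?X \<inter> ?Y \<subseteq> {{x, y}}" by blast
  then have 2: "card (?X \<inter> ?Y) \<le> 1" using card_mono[of "{{x, y}}"] by simp
  have 3: "card ?X + card ?Y = card (?X \<union> ?Y) + card (?X \<inter> ?Y)"
    using fin by (intro card_Un_Int) auto
  have "card (?X \<union> ?Y) + card ?M = card ((?X \<union> ?Y) \<union> ?M)"
    using fin M(3) by (intro card_Un_disjoint[symmetric]) auto
  also have "\<dots> \<le> card E"
    using fin M(1) by (intro card_mono) (auto simp: is_matching_def)
  finally show ?thesis using 1 2 3 M(2) by (simp add: degree_def)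
qed

lemma matching_vertices:
  assumes "simple_graph V E" "is_matching E M" "finite M"
  shows "card (\<Union>M) = 2 * card M" "\<Union>M \<subseteq> V"
proof -
  have "card (\<Union>M) = (\<Sum>e\<in>M. card e)"
  proof (rule card_Union_disjoint)
    show "pairwise disjnt M" using assms(2) by (simp add: is_matching_def pairwise_def disjnt_def)
    fix e assume "e \<in> M"
    then have "card e = 2" using assms by (auto simp: is_matching_def simple_graph_def)
    then show "finite e" by (intro card_ge_0_finite) simp
  qed
  also have "\<dots> = (\<Sum>e\<in>M. 2)"
    using assms by (intro sum.cong refl) (auto simp: is_matching_def simple_graph_def)
  finally show "card (\<Union>M) = 2 * card M" by simp
  show "\<Union>M \<subseteq> V" using assms by (auto simp: is_matching_def simple_graph_def)
qed

text \<open>A matching covers at most one pendent neighbour of \<open>v\<close>, since each such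
  edge uses \<open>v\<close>; all the others are among the unmatched vertices.\<close>

lemma pendants_matching_le:
  assumes sg: "simple_graph V E"
  shows "card {u \<in> nbrs E v. degree E u = 1} + 2 * matching_number E \<le> card V + 1"
proof -
  have fin: "finite E" "finite V" using simple_graph_finite[OF sg] by auto
  obtain M where M: "is_matching E M" "card M = matching_number E" "finite M"
    using max_matchingE[OF fin(1)] .
  let ?P = "{u \<in> nbrs E v. degree E u = 1}"
  have P: "?P \<subseteq> V" using simple_graph_nbrs(1)[OF sg] by auto
  have "u = u'" if "u \<in> ?P \<inter> \<Union>M" "u' \<in> ?P \<inter> \<Union>M" for u u'
  proof -
    have *: "{x, v} \<in> M" if x: "x \<in> ?P \<inter> \<Union>M" for x
    proof -
      obtain e where e: "x \<in> e" "e \<in> M" using x by auto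
      have "degree E x = 1" "{x, v} \<in> E" using x by (auto simp: nbrs_def insert_commute)
      from leaf_edge[OF sg this matching_edge[OF M(1) e(2)] e(1)] e(2) show ?thesis by simp
    qed
    have "{u, v} = {u', v}"
      by (rule matching_unique[OF M(1) *[OF that(1)] *[OF that(2)], of v]) simp_all
    moreover have "u \<noteq> v" "u' \<noteq> v" using that simple_graph_nbrs(2)[OF sg] by auto
    ultimately show ?thesis by (auto simp: doubleton_eq_iff)
  qed
  then have "\<exists>x. ?P \<inter> \<Union>M \<subseteq> {x}" by blast
  then obtain x where "?P \<inter> \<Union>M \<subseteq> {x}" by blast
  then have 1: "card (?P \<inter> \<Union>M) \<le> 1" using card_mono[of "{x}"] by simp
  have finP: "finite ?P" "finite (\<Union>M)" using fin P matching_vertices(2)[OF sg M(1,3)] finite_subset by blast+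
  have "card ?P + card (\<Union>M) = card (?P \<union> \<Union>M) + card (?P \<inter> \<Union>M)"
    using finP by (intro card_Un_Int)
  moreover have "card (?P \<union> \<Union>M) \<le> card V"
    using fin P matching_vertices(2)[OF sg M(1,3)] by (intro card_mono) auto
  ultimately show ?thesis using 1 matching_vertices(1)[OF sg M(1,3)] M(2) by simp
qed

lemma matching_number_le:
  assumes sg: "simple_graph V E" shows "2 * matching_number E \<le> card V"
proof -
  have fin: "finite E" "finite V" using simple_graph_finite[OF sg] by auto
  obtain M where M: "is_matching E M" "card M = matching_number E" "finite M"
    using max_matchingE[OF fin(1)] .
  show ?thesis
    using matching_vertices[OF sg M(1,3)] M(2) card_mono[of V "\<Union>M"] fin by simp
qed

text \<open>Removing \<open>x\<close> costs a matching at most one edge; conversely the pendent edge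
  can be added to any matching that avoids both of its ends.\<close>

lemma matching_number_leaf:
  assumes sg: "simple_graph V E" and u: "degree E u = 1" "{u, x} \<in> E"
  shows "matching_number E = matching_number (del (del E u) x) + 1"
proof -
  have fin: "finite E" "finite (del (del E u) x)" using simple_graph_finite[OF sg] by (auto simp: del_def)
  have eq: "del (del E u) x = del E x"
  proof (intro equalityI subsetI)
    fix e assume e: "e \<in> del E x"
    then have "u \<notin> e" using leaf_edge[OF sg u, of e] by (auto simp: del_def)
    with e show "e \<in> del (del E u) x" by (simp add: del_def)
  qed (simp add: del_def)
  obtain M where M: "is_matching E M" "card M = matching_number E" "finite M"
    using max_matchingE[OF fin(1)] .
  have "is_matching (del (del E u) x) {e \<in> M. x \<notin> e}"
    unfolding eq using M(1) by (auto simp: is_matching_def del_def)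
  from matching_card_le[OF fin(2) this] matching_avoid[OF M(1,3), of x] M(2)
  have 1: "matching_number E \<le> matching_number (del (del E u) x) + 1" by simp
  obtain M' where M': "is_matching (del (del E u) x) M'" "card M' = matching_number (del (del E u) x)" "finite M'"
    using max_matchingE[OF fin(2)] .
  have "is_matching E (insert {u, x} M')" "{u, x} \<notin> M'"
    using M'(1) u(2) by (auto simp: is_matching_def del_def)
  from matching_card_le[OF fin(1) this(1)] this(2) M' 1 show ?thesis by simp
qed

text \<open>A maximum matching misses one of two pendent vertices with a common neighbour, and that
  one can be deleted. Hence a graph without a removable pendent vertex has at most one pendent
  neighbour per vertex.\<close>

lemma matching_number_two_leaves:
  assumes sg: "simple_graph V E" and u: "u \<noteq> u'" "u \<in> nbrs E v" "u' \<in> nbrs E v"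
    and deg: "degree E u = 1" "degree E u' = 1"
  shows "\<exists>x\<in>{u, u'}. matching_number (del E x) = matching_number E"
proof -
  have fin: "finite E" using simple_graph_finite[OF sg] by auto
  obtain M where M: "is_matching E M" "card M = matching_number E" "finite M"
    using max_matchingE[OF fin] .
  have uv: "{u, v} \<in> E" "{u', v} \<in> E" using u(2,3) by (simp_all add: nbrs_def insert_commute)
  have "\<exists>x\<in>{u, u'}. x \<notin> \<Union>M"
  proof (rule ccontr)
    assume "\<not> ?thesis"
    then have "u \<in> \<Union>M" "u' \<in> \<Union>M" by simp_all
    then obtain e e' where e: "u \<in> e" "e \<in> M" "u' \<in> e'" "e' \<in> M" by (elim UnionE)
    have eq: "e = {u, v}" "e' = {u', v}"
      using leaf_edge[OF sg deg(1) uv(1) matching_edge[OF M(1) e(2)] e(1)]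
        leaf_edge[OF sg deg(2) uv(2) matching_edge[OF M(1) e(4)] e(3)] .
    have "v \<in> e" "v \<in> e'" unfolding eq by simp_all
    then have "e = e'" by (rule matching_unique[OF M(1) e(2,4)])
    then have "{u, v} = {u', v}" unfolding eq .
    then show False using u(1) by (auto simp: doubleton_eq_iff)
  qed
  then obtain x where x: "x \<in> {u, u'}" "x \<notin> \<Union>M" by blast
  then have "is_matching (del E x) M" using M(1) by (auto simp: is_matching_def del_def)
  moreover have "finite (del E x)" using fin by (simp add: del_def)
  ultimately have "matching_number E \<le> matching_number (del E x)"
    using matching_card_le[of "del E x" M] M(2) by simp
  with matching_number_del_le[OF fin, of x] have "matching_number (del E x) = matching_number E"
    by simp
  with x(1) show ?thesis by blast
qed

lemma bicyclic_leaf: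
  assumes bi: "bicyclic V E" and u: "degree E u = 1"
  shows "bicyclic (V - {u}) (del E u)" "card V = card (V - {u}) + 1"
proof -
  have sg: "simple_graph V E" and conn: "connected_graph V E" and card: "card E = card V + 1"
    using bi by (auto simp: bicyclic_def)
  obtain v where v: "{u, v} \<in> E" "v \<noteq> u" "u \<in> V" "v \<in> V" using leafE[OF sg u] .
  show cV: "card V = card (V - {u}) + 1"
    using card.remove[OF _ v(3)] simple_graph_finite[OF sg] unfolding Suc_eq_plus1 by blast
  let ?R = "{(x, y). {x, y} \<in> E}" and ?R' = "{(x, y). {x, y} \<in> del E u}"
  have "(x, y) \<in> ?R'\<^sup>*" if "x \<in> V - {u}" "y \<in> V - {u}" for x y
  proof -
    have "(x, y) \<in> ?R\<^sup>*" using conn that by (auto simp: connected_graph_def)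
    \<comment> \<open>A walk can enter and leave \<open>u\<close> only through \<open>v\<close>.
      Replacing each visit to \<open>u\<close> by a stay at \<open>v\<close> gives a claim that also
      covers intermediate walks ending in \<open>u\<close>.\<close>
    then have "(x, if y = u then v else y) \<in> ?R'\<^sup>*"
    proof (induction rule: rtrancl_induct)
      case base
      then show ?case using that by simp
    next
      case (step y z)
      then have yz: "{y, z} \<in> E" by simp
      show ?case
      proof (cases "y = u \<or> z = u")
        case True
        then have "{y, z} = {u, v}" using leaf_edge[OF sg u v(1) yz] by auto
        then have "(if y = u then v else y) = (if z = u then v else z)"
          by (auto simp: doubleton_eq_iff)
        then show ?thesis using step.IH by simp
      next
        case False
        then have "{y, z} \<in> del E u" using yz by (auto simp: del_def)
        then show ?thesis using step.IH False by (auto intro: rtrancl_into_rtrancl)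
      qed
    qed
    then show ?thesis using that by simp
  qed
  then have "connected_graph (V - {u}) (del E u)"
    using v by (auto simp: connected_graph_def)
  moreover have "card (del E u) = card (V - {u}) + 1"
    using card_del[OF sg, of u] card cV u by simp
  ultimately show "bicyclic (V - {u}) (del E u)"
    using simple_graph_del[OF sg] by (auto simp: bicyclic_def)
qed

section \<open>Graphs of minimum degree two with pendent vertices attached\<close>

text \<open>The graph \<open>H\<close> is what remains after stripping all pendent vertices. These
  are recorded only by the set \<open>S\<close> of their neighbours, which suffices because each
  vertex carries at most one of them.\<close>

locale core_graph =
  fixes C :: "'a set" and H :: "'a set set" and S :: "'a set"
  assumes sg: "simple_graph C H"
    and card_H: "card H = card C + 1"
    and deg_ge: "v \<in> C \<Longrightarrow> 2 \<le> degree H v"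
    and S_sub: "S \<subseteq> C"
begin

definition attached :: "'a \<Rightarrow> real" where
  "attached v = (if v \<in> S then 1 else 0)"

text \<open>The index of the graph obtained from \<open>H\<close> by attaching one pendent vertex to
  each element of \<open>S\<close>; a pendent edge at \<open>v\<close> has degree sum (degree H v +
  1) + 1.\<close>

definition core_index :: real where
  "core_index = (\<Sum>e\<in>H. inv_sqrt (\<Sum>v\<in>e. real (degree H v) + attached v)) + (\<Sum>v\<in>S. inv_sqrt (real (degree H v) + 2))"

lemma finite_C: "finite C" and finite_H: "finite H" and finite_S: "finite S"
  using simple_graph_finite[OF sg] finite_subset[OF S_sub] by auto

lemma sum_s: "S \<subseteq> A \<Longrightarrow> finite A \<Longrightarrow> sum attached A = real (card S)"
  unfolding attached_def by (simp add: sum.If_cases Int_absorb1)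

lemma sum_excess: "(\<Sum>v\<in>C. degree H v - 2) = 2"
proof -
  have "real (\<Sum>v\<in>C. degree H v - 2) = (\<Sum>v\<in>C. real (degree H v) - 2)"
    unfolding of_nat_sum using deg_ge by (intro sum.cong refl) (simp add: of_nat_diff)
  also have "\<dots> = 2"
    using handshake_card[OF sg] card_H by (simp add: sum_subtractf)
  finally show ?thesis by linarith
qed

text \<open>The total excess over degree two is 2(k+1) - 2k = 2, so it sits at one vertex or is
  shared equally by two.\<close>

lemma degree_cases:
  obtains (one) c where "c \<in> C" "degree H c = 4" "\<And>v. v \<in> C - {c} \<Longrightarrow> degree H v = 2"
  | (two) x y where "x \<in> C" "y \<in> C" "x \<noteq> y" "degree H x = 3" "degree H y = 3"
      "\<And>v. v \<in> C - {x, y} \<Longrightarrow> degree H v = 2"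
proof (cases "\<exists>c\<in>C. 4 \<le> degree H c")
  case True
  then obtain c where c: "c \<in> C" "4 \<le> degree H c" by blast
  have "degree H c - 2 + (\<Sum>v\<in>C - {c}. degree H v - 2) = 2"
    using sum.remove[OF finite_C c(1), of "\<lambda>v. degree H v - 2"] sum_excess by simp
  with c(2) have "degree H c = 4" "(\<Sum>v\<in>C - {c}. degree H v - 2) = 0" by linarith+
  moreover from this(2) have "degree H v = 2" if "v \<in> C - {c}" for v
    using that deg_ge[of v] finite_C by (auto simp: le_antisym)
  ultimately show thesis using one c(1) by blast
next
  case False
  let ?T = "{v \<in> C. degree H v = 3}"
  have *: "degree H v = 2 \<or> degree H v = 3" if "v \<in> C" for v
  proof -
    have "\<not> 4 \<le> degree H v" using False that by blast
    with deg_ge[OF that] show ?thesis by linarith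
  qed
  have "(\<Sum>v\<in>C. degree H v - 2) = (\<Sum>v\<in>C. if degree H v = 3 then 1 else 0)"
  proof (intro sum.cong refl)
    fix v assume "v \<in> C"
    from *[OF this] show "degree H v - 2 = (if degree H v = 3 then 1 else 0)" by auto
  qed
  also have "\<dots> = card ?T" using finite_C by (simp add: sum.If_cases Int_def)
  finally have "card ?T = 2" using sum_excess by simp
  then obtain x y where T: "?T = {x, y}" "x \<noteq> y" by (auto simp: card_2_iff)
  then have "x \<in> ?T" "y \<in> ?T" by auto
  moreover have "degree H v = 2" if "v \<in> C - {x, y}" for v
  proof -
    have "v \<notin> ?T" using T that by simp
    with *[of v] that show ?thesis by auto
  qed
  ultimately show thesis using two T(2) by blast
qed

text \<open>In the sum below, \<open>Q\<close> counts pairs of an edge avoiding \<open>c\<close> and an attached end vertex. A vertex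
  other than \<open>c\<close> has two such edges only if it is not adjacent to \<open>c\<close>, and there are just
  \<open>card C - 5\<close> of these.\<close>

lemma core_index_one:
  assumes c: "c \<in> C" "degree H c = 4" and two: "\<And>v. v \<in> C - {c} \<Longrightarrow> degree H v = 2"
  shows "5 \<le> card C"
    and "core_index > extremal 6 3 + 0.41 * (real (card C + card S) - 6) \<or> (card C = 5 \<and> S = {c} \<and> core_index \<ge> extremal 6 3)"
proof -
  let ?N = "nbrs H c" and ?C = "C - {c}" and ?D = "del H c"
  define k q where "k = real (card C)" and "q = real (card (S - {c}))"
  define \<delta> where "\<delta> = inv_sqrt (6 + attached c) - inv_sqrt (7 + attached c)"
  define Q where "Q = (\<Sum>v\<in>?C. real (degree ?D v) * attached v)"
  have N: "?N \<subseteq> ?C" "finite ?N" "card ?N = 4"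
    using simple_graph_nbrs(1,2,3)[OF sg, of c] degree_nbrs[OF sg, of c] c by auto
  have cC: "card C = card ?C + 1" using card.remove[OF finite_C c(1)] by simp
  have "4 \<le> card ?C" using card_mono[OF _ N(1)] N(3) finite_C by simp
  with cC show "5 \<le> card C" by simp
  then have k5: "5 \<le> k" by (simp add: k_def)
  have s01: "attached v = 0 \<or> attached v = 1" for v by (simp add: attached_def)
  have sgD: "simple_graph ?C ?D" by (rule simple_graph_del[OF sg])
  have degD: "real (degree ?D v) = 2 - (if v \<in> ?N then 1 else 0)" if "v \<in> ?C" for v
    using degree_del[OF sg, of v c] two[OF that] that nbrs_sym[of c H v] by auto
  have cD: "real (card ?D) = k - 3"
    using card_del[OF sg, of c] c card_H by (simp add: k_def)
  have sum_s': "sum attached ?C = q"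
  proof -
    have "sum attached ?C = (\<Sum>v\<in>?C. if v \<in> S - {c} then 1 else 0)"
      by (intro sum.cong refl) (auto simp: attached_def)
    also have "\<dots> = real (card (?C \<inter> (S - {c})))"
      using finite_C by (auto intro!: arg_cong[where f = card] simp: sum.If_cases)
    also have "?C \<inter> (S - {c}) = S - {c}" using S_sub by auto
    finally show ?thesis by (simp add: q_def)
  qed
  have sumN: "sum attached ?N = 2 * q - Q"
  proof -
    have "(\<Sum>v\<in>?C. (2 - real (degree ?D v)) * attached v) = 2 * sum attached ?C - Q"
      unfolding left_diff_distrib sum_subtractf sum_distrib_left Q_def ..
    then have "2 * q - Q = (\<Sum>v\<in>?C. (2 - real (degree ?D v)) * attached v)"
      unfolding sum_s' by simp
    also have "\<dots> = (\<Sum>v\<in>?C. if v \<in> ?N then attached v else 0)"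
      using degD by (intro sum.cong refl) simp
    also have "\<dots> = sum attached (?C \<inter> ?N)"
      using finite_C by (simp add: sum.inter_restrict)
    also have "?C \<inter> ?N = ?N" using N(1) by blast
    finally show ?thesis by simp
  qed
  have Q_le: "Q \<le> q + k - 5"
  proof -
    \<comment> \<open>With a in {0,1} for attachment and d in {1,2} for the degree after deletion of
      \<open>c\<close>, the termwise bound a d <= a + (d - 1) is (1 - a)(d - 1) >= 0.\<close>
    have "Q \<le> (\<Sum>v\<in>?C. attached v + (real (degree ?D v) - 1))"
      unfolding Q_def
    proof (rule sum_mono)
      fix v assume "v \<in> ?C"
      then show "real (degree ?D v) * attached v \<le> attached v + (real (degree ?D v) - 1)"
        using degD[of v] s01[of v] by auto
    qed
    also have "\<dots> = q + (2 * (k - 3) - real (card ?C))"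
      using handshake_card[OF sgD] cD by (simp add: sum.distrib sum_subtractf sum_s')
    finally show ?thesis using cC by (simp add: k_def)
  qed
  have 1: "(\<Sum>w\<in>?N. inv_sqrt (\<Sum>v\<in>{c, w}. real (degree H v) + attached v)) = 4 * inv_sqrt (6 + attached c) - \<delta> * (2 * q - Q)"
  proof -
    have "(\<Sum>w\<in>?N. inv_sqrt (\<Sum>v\<in>{c, w}. real (degree H v) + attached v)) = (\<Sum>w\<in>?N. inv_sqrt (6 + attached c) - \<delta> * attached w)"
    proof (intro sum.cong refl)
      fix w assume "w \<in> ?N"
      then have "w \<noteq> c" "degree H w = 2" using N(1) two by auto
      then show "inv_sqrt (\<Sum>v\<in>{c, w}. real (degree H v) + attached v) = inv_sqrt (6 + attached c) - \<delta> * attached w"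
        using c(2) s01[of w] by (auto simp: \<delta>_def add_ac)
    qed
    then show ?thesis
      using N(3) by (simp add: sum_subtractf sum_distrib_left[symmetric] sumN)
  qed
  have 2: "(\<Sum>e\<in>?D. inv_sqrt (\<Sum>v\<in>e. real (degree H v) + attached v)) \<ge> (k - 3) / 2 - 0.0528 * Q"
  proof -
    \<comment> \<open>An edge off \<open>c\<close> has degree sum 4, 5 or 6. The constant 0.0528 is
      just above 1/2 - 1/sqrt 5, so this line starts at the value for 4 and stays below the other
      two.\<close>
    have "(\<Sum>e\<in>?D. 1/2 - 0.0528 * (\<Sum>v\<in>e. attached v)) \<le> (\<Sum>e\<in>?D. inv_sqrt (\<Sum>v\<in>e. real (degree H v) + attached v))"
    proof (rule sum_mono)
      fix e assume e: "e \<in> ?D"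
      then obtain x y where xy: "e = {x, y}" "x \<noteq> y" "x \<in> ?C" "y \<in> ?C"
        using sgD by (auto simp: simple_graph_def card_2_iff)
      then have "(\<Sum>v\<in>e. real (degree H v) + attached v) = 4 + (attached x + attached y)" "(\<Sum>v\<in>e. attached v) = attached x + attached y"
        using two by auto
      then show "1/2 - 0.0528 * (\<Sum>v\<in>e. attached v) \<le> inv_sqrt (\<Sum>v\<in>e. real (degree H v) + attached v)"
        using s01[of x] s01[of y] inv_sqrt_numeric inv_sqrt_4 by auto
    qed
    moreover have "(\<Sum>e\<in>?D. \<Sum>v\<in>e. attached v) = Q" using handshake[OF sgD] by (simp add: Q_def)
    then have "(\<Sum>e\<in>?D. 1/2 - 0.0528 * (\<Sum>v\<in>e. attached v)) = (k - 3) / 2 - 0.0528 * Q"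
      unfolding sum_subtractf sum_distrib_left[symmetric] sum_constant cD by simp
    ultimately show ?thesis by (simp only:)
  qed
  have 3: "(\<Sum>v\<in>S. inv_sqrt (real (degree H v) + 2)) = attached c * inv_sqrt 6 + q / 2"
  proof -
    have "(\<Sum>v\<in>S - {c}. inv_sqrt (real (degree H v) + 2)) = (\<Sum>v\<in>S - {c}. 1/2)"
    proof (intro sum.cong refl)
      fix v assume "v \<in> S - {c}"
      then have "degree H v = 2" using two S_sub by auto
      then show "inv_sqrt (real (degree H v) + 2) = 1/2" using inv_sqrt_4 by simp
    qed
    also have "\<dots> = q / 2" by (simp add: q_def)
    finally have rest: "(\<Sum>v\<in>S - {c}. inv_sqrt (real (degree H v) + 2)) = q / 2" .
    show ?thesis
    proof (cases "c \<in> S")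
      case True
      then show ?thesis
        unfolding sum.remove[OF finite_S True, of "\<lambda>v. inv_sqrt (real (degree H v) + 2)"] rest
        using c(2) by (simp add: attached_def)
    next
      case False
      then have "S - {c} = S" by auto
      with rest False show ?thesis by (simp add: attached_def)
    qed
  qed
  have q0: "0 \<le> q" by (simp add: q_def)
  have Q0: "0 \<le> Q" unfolding Q_def by (intro sum_nonneg) (simp add: attached_def)
  define A B where "A = \<delta> * q" and "B = \<delta> * Q"
  have \<delta>Q: "\<delta> * (2 * q - Q) = 2 * A - B" by (simp add: A_def B_def algebra_simps)
  have core_index: "core_index \<ge> 4 * inv_sqrt (6 + attached c) - \<delta> * (2 * q - Q) + ((k - 3) / 2 - 0.0528 * Q) + (attached c * inv_sqrt 6 + q / 2)"
    using 1 2 3 unfolding core_index_def sum_edges_split[OF sg, of _ c] by linarith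
  have cS: "real (card S) = q + attached c"
  proof (cases "c \<in> S")
    case True
    then show ?thesis unfolding card.remove[OF finite_S True] by (simp add: attached_def q_def)
  next
    case False
    then have "S - {c} = S" by auto
    with False show ?thesis by (simp add: attached_def q_def)
  qed
  show "core_index > extremal 6 3 + 0.41 * (real (card C + card S) - 6) \<or> (card C = 5 \<and> S = {c} \<and> core_index \<ge> extremal 6 3)"
  proof (cases "c \<in> S")
    case True
    then have sc: "attached c = 1" by (simp add: attached_def)
    have d: "0.0244 \<le> \<delta>" "\<delta> \<le> 0.02442" using inv_sqrt_numeric sc by (auto simp: \<delta>_def)
    have "A \<le> 0.02442 * q" "0.0244 * Q \<le> B" unfolding A_def B_def
      using d q0 Q0 by (intro mult_right_mono; simp)+
    moreover have "core_index \<ge> 4 * inv_sqrt 7 - (2 * A - B) + ((k - 3) / 2 - 0.0528 * Q) + (inv_sqrt 6 + q / 2)"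
      using core_index[unfolded \<delta>Q] sc by simp
    \<comment> \<open>The net coefficient 0.0244 - 0.0528 of \<open>Q\<close> is negative, so
      \<open>Q_le\<close> applies. Both slopes remain above 0.41, which makes the comparison with
      the line strict except at k = 5, q = 0.\<close>
    ultimately have "core_index \<ge> extremal 6 3 + 0.42 * (k - 5) + 0.42 * q"
      using extremal_6_3(3) k5 q0 Q0 Q_le by (simp add: field_simps)
    moreover have n: "real (card C + card S) - 6 = (k - 5) + q"
      unfolding of_nat_add cS sc k_def by linarith
    moreover have "card C = 5 \<and> S = {c}" if "k - 5 = 0 \<and> q = 0"
    proof -
      have "card C = 5" using that by (simp add: k_def)
      moreover have "S - {c} = {}" using that finite_S by (simp add: q_def)
      ultimately show ?thesis using True by blast
    qed
    moreover have "0 < (k - 5) + q" if "\<not> (k - 5 = 0 \<and> q = 0)"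
      using that k5 q0 by linarith
    ultimately show ?thesis
      unfolding n using k5 q0 by (cases "k - 5 = 0 \<and> q = 0") (simp_all add: field_simps)
  next
    case False
    then have sc: "attached c = 0" by (simp add: attached_def)
    have d: "0.0302 \<le> \<delta>" "\<delta> \<le> 0.0303" using inv_sqrt_numeric sc by (auto simp: \<delta>_def)
    have "A \<le> 0.0303 * q" "0.0302 * Q \<le> B" unfolding A_def B_def
      using d q0 Q0 by (intro mult_right_mono; simp)+
    moreover have "core_index \<ge> 4 * inv_sqrt 6 - (2 * A - B) + ((k - 3) / 2 - 0.0528 * Q) + q / 2"
      using core_index[unfolded \<delta>Q] sc by simp
    \<comment> \<open>Here the slope in \<open>q\<close> merely matches the line. Strictness comes
      from the constant: without a pendent vertex at \<open>c\<close> there is one vertex fewer, and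
      4/sqrt 6 + 1 exceeds \<open>extremal 6 3 - 0.41\<close>.\<close>
    ultimately have "core_index \<ge> 4 * inv_sqrt 6 + 1 + 0.42 * (k - 5) + 0.41 * q"
      using k5 q0 Q0 Q_le by (simp add: field_simps)
    moreover have "real (card C + card S) - 6 = (k - 5) + q - 1"
      unfolding of_nat_add cS sc k_def by linarith
    ultimately have "core_index > extremal 6 3 + 0.41 * (real (card C + card S) - 6)"
      using k5 q0 inv_sqrt_numeric(5) extremal_6_3(2) by (simp add: field_simps)
    then show ?thesis by blast
  qed
qed

text \<open>Once the summands are bounded below by a line in the excess of the edge, weighted
  handshaking evaluates their sum from the degrees alone, so it does not matter how the two vertices
  of degree three are connected. The line is left open because no single one serves all
  sizes.\<close>

lemma core_index_two:
  assumes xy: "x \<in> C" "y \<in> C" "x \<noteq> y" "degree H x = 3" "degree H y = 3"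
    and two: "\<And>v. v \<in> C - {x, y} \<Longrightarrow> degree H v = 2"
    and line: "\<And>t. t \<le> 4 \<Longrightarrow> \<alpha> - \<beta> * real t \<le> inv_sqrt (4 + real t)"
  defines "\<tau> \<equiv> attached x + attached y"
  shows "core_index \<ge> \<alpha> * (real (card C) + 1) - \<beta> * (6 + 2 * real (card S) + \<tau>)
      + (real (card S) - \<tau>) / 2 + \<tau> * inv_sqrt 5"
proof -
  have C: "C = insert x (insert y (C - {x, y}))" "finite (C - {x, y})" using xy finite_C by auto
  have split: "sum g C = g x + g y + sum g (C - {x, y})" for g :: "'a \<Rightarrow> real"
    by (subst C(1)) (use C(2) xy(3) in simp)
  \<comment> \<open>The excess over degree two in the whole graph, taken as a natural number so that
    the line has to be checked at integers up to 4 only.\<close>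
  define t where "t v = degree H v - 2 + (if v \<in> S then 1 else 0)" for v
  have t: "real (t v) = real (degree H v) + attached v - 2" if "v \<in> C" for v
    using deg_ge[OF that] by (simp add: t_def attached_def)
  have t_le: "t v \<le> 2" if "v \<in> C" for v
    using two[of v] xy that by (cases "v \<in> {x, y}") (auto simp: t_def)
  have sum_rest: "sum attached (C - {x, y}) = real (card S) - \<tau>"
    using split[of attached] sum_s[OF S_sub finite_C] by (simp add: \<tau>_def)
  have "(\<Sum>e\<in>H. \<Sum>v\<in>e. real (t v)) = (\<Sum>v\<in>C. real (degree H v) * real (t v))"
    by (rule handshake[OF sg])
  also have "\<dots> = 3 * (1 + attached x) + 3 * (1 + attached y) + (\<Sum>v\<in>C - {x, y}. 2 * attached v)"
    using xy t two by (subst split) simp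
  also have "\<dots> = 6 + 2 * real (card S) + \<tau>"
    by (simp add: sum_distrib_left[symmetric] sum_rest) (simp add: \<tau>_def)
  finally have sum_t: "(\<Sum>e\<in>H. \<Sum>v\<in>e. real (t v)) = 6 + 2 * real (card S) + \<tau>" .
  have "(\<Sum>e\<in>H. \<alpha> - \<beta> * (\<Sum>v\<in>e. real (t v))) \<le> (\<Sum>e\<in>H. inv_sqrt (\<Sum>v\<in>e. real (degree H v) + attached v))"
  proof (rule sum_mono)
    fix e assume "e \<in> H"
    then obtain u w where uw: "e = {u, w}" "u \<noteq> w" "u \<in> C" "w \<in> C"
      using sg by (auto simp: simple_graph_def card_2_iff)
    have "(\<Sum>v\<in>e. real (degree H v) + attached v) = 4 + real (t u + t w)"
      using uw t[of u] t[of w] by simp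
    moreover have "(\<Sum>v\<in>e. real (t v)) = real (t u + t w)" using uw by simp
    moreover have "t u + t w \<le> 4" using t_le[OF uw(3)] t_le[OF uw(4)] by simp
    ultimately show "\<alpha> - \<beta> * (\<Sum>v\<in>e. real (t v)) \<le> inv_sqrt (\<Sum>v\<in>e. real (degree H v) + attached v)"
      using line[of "t u + t w"] by presburger
  qed
  moreover have "(\<Sum>v\<in>S. inv_sqrt (real (degree H v) + 2)) = (real (card S) - \<tau>) / 2 + \<tau> * inv_sqrt 5"
  proof -
    have "(\<Sum>v\<in>S. inv_sqrt (real (degree H v) + 2)) = (\<Sum>v\<in>C. attached v * inv_sqrt (real (degree H v) + 2))"
      unfolding attached_def using finite_C S_sub
      by (simp add: if_distrib sum.inter_restrict[symmetric] Int_absorb1 if_distribR cong: if_cong)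
    also have "\<dots> = attached x * inv_sqrt 5 + attached y * inv_sqrt 5 + (\<Sum>v\<in>C - {x, y}. attached v * (1/2))"
      using xy two by (subst split) (simp add: inv_sqrt_4)
    also have "(\<Sum>v\<in>C - {x, y}. attached v * (1/2)) = (real (card S) - \<tau>) / 2"
      using sum_rest by (simp add: sum_divide_distrib[symmetric])
    finally show ?thesis by (simp add: \<tau>_def algebra_simps)
  qed
  ultimately show ?thesis
    using card_H by (simp add: core_index_def sum_subtractf sum_distrib_left[symmetric] sum_t algebra_simps)
qed

text \<open>The last two alternatives arise when pendent vertices are attached to both vertices of degree three
  of \<open>K\<^sub>4\<close> minus an edge. They can fall below the line and are excluded later: in the first one the
  number of vertices is odd, in the second one the matching number is at most two.\<close>

lemma core_index_bound:
  "4 \<le> card C"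
  "core_index > extremal 6 3 + 0.41 * (real (card C + card S) - 6)
   \<or> (\<exists>c\<in>C. card C = 5 \<and> degree H c = 4 \<and> S = {c} \<and> core_index \<ge> extremal 6 3)
   \<or> (card C = 4 \<and> card S = 3 \<and> core_index \<ge> 3.3)
   \<or> (\<exists>x y. card C = 4 \<and> x \<noteq> y \<and> degree H x = 3 \<and> degree H y = 3 \<and> S = {x, y} \<and> core_index \<ge> 2.8)"
  (is "?A \<or> ?B \<or> ?D \<or> ?F")
proof -
  have "4 \<le> card C \<and> (?A \<or> ?B \<or> ?D \<or> ?F)"
  proof (cases rule: degree_cases)
    case (one c)
    with core_index_one[OF one] show ?thesis by auto
  next
    case (two x y)
    define k p \<tau> where "k = real (card C)" and "p = real (card S)" and "\<tau> = attached x + attached y"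
    have "card (nbrs H x) = 3" "nbrs H x \<subseteq> C - {x}"
      using degree_nbrs[OF sg, of x] simple_graph_nbrs(1,2)[OF sg, of x] two(4) by auto
    then have "3 \<le> card (C - {x})" using card_mono[of "C - {x}" "nbrs H x"] finite_C by simp
    then have k4: "4 \<le> card C" using two(1) finite_C by simp
    \<comment> \<open>Chords of $1/\sqrt{4+t}$ through \<open>t = 1, 2\<close> and through \<open>t = 2, 3\<close>.\<close>
    have L1: "0.48618 - 0.03897 * real t \<le> inv_sqrt (4 + real t)" if "t \<le> 4" for t
    proof -
      from that consider "t = 0" | "t = 1" | "t = 2" | "t = 3" | "t = 4" by linarith
      then show ?thesis using inv_sqrt_numeric inv_sqrt_4 by cases simp_all
    qed
    have L2: "0.46882 - 0.03029 * real t \<le> inv_sqrt (4 + real t)" if "t \<le> 4" for t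
    proof -
      from that consider "t = 0" | "t = 1" | "t = 2" | "t = 3" | "t = 4" by linarith
      then show ?thesis using inv_sqrt_numeric inv_sqrt_4 by cases simp_all
    qed
    have X1: "core_index \<ge> 0.48618 * (k + 1) - 0.03897 * (6 + 2 * p + \<tau>) + (p - \<tau>) / 2 + \<tau> * inv_sqrt 5"
      using core_index_two[OF two L1] by (simp add: k_def p_def \<tau>_def)
    have X2: "core_index \<ge> 0.46882 * (k + 1) - 0.03029 * (6 + 2 * p + \<tau>) + (p - \<tau>) / 2 + \<tau> * inv_sqrt 5"
      using core_index_two[OF two L2] by (simp add: k_def p_def \<tau>_def)
    have pk: "card S \<le> card C" using card_mono[OF finite_C S_sub] .
    have "real (card (S \<inter> {x, y})) = \<tau>"
      using two(3) by (auto simp: attached_def \<tau>_def Int_insert_right)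
    moreover have "card (S \<inter> {x, y}) \<le> card S" using finite_S by (intro card_mono) auto
    ultimately have \<tau>p: "\<tau> \<le> p" by (simp add: p_def)
    have \<tau>: "\<tau> = 0 \<or> \<tau> = 1 \<or> \<tau> = 2" by (auto simp: attached_def \<tau>_def)
    then have \<tau>_le: "0 \<le> \<tau>" "\<tau> \<le> 2" by auto
    have \<tau>inv_sqrt: "\<tau> * inv_sqrt 5 \<ge> \<tau> * 0.44721" using \<tau> inv_sqrt_numeric by auto
    show ?thesis
    \<comment> \<open>The first chord settles all but four core vertices with both vertices of
      degree three attached. There the mean excess per edge is (8 + 2p)/5, between 2.4 and 3.2,
      where the chord through 2 and 3 is the higher one.\<close>
    proof (cases "5 \<le> card C \<or> \<tau> \<le> 1")
      case True
      have kp: "real (card C + card S) = k + p" by (simp add: k_def p_def)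
      from True have "?A"
      proof
        assume "5 \<le> card C"
        then have "5 \<le> k" by (simp add: k_def)
        then show ?A unfolding kp using X1 \<tau>inv_sqrt \<tau>p \<tau>_le extremal_6_3(2) by (simp add: field_simps)
      next
        assume "\<tau> \<le> 1"
        moreover have "4 \<le> k" using k4 by (simp add: k_def)
        ultimately show ?A unfolding kp using X1 \<tau>inv_sqrt \<tau>p \<tau>_le extremal_6_3(2) by (simp add: field_simps)
      qed
      with k4 show ?thesis by blast
    next
      case False
      then have C4: "card C = 4" and \<tau>2: "\<tau> = 2" using k4 \<tau> by auto
      then have xyS: "x \<in> S" "y \<in> S" by (auto simp: \<tau>_def attached_def split: if_splits)
      have "2 \<le> p" using \<tau>p \<tau>2 by simp
      then have "card S = 2 \<or> card S = 3 \<or> card S = 4" using pk C4 by (auto simp: p_def)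
      then have "?A \<or> ?D \<or> ?F"
      proof (elim disjE)
        assume S: "card S = 2"
        have "{x, y} = S" using xyS two(3) S finite_S by (intro card_subset_eq) auto
        moreover have "core_index \<ge> 2.8" using X2 \<tau>2 inv_sqrt_numeric C4 S by (simp add: k_def p_def)
        ultimately have ?F using C4 two by auto
        then show ?thesis by blast
      next
        assume S: "card S = 3"
        have "core_index \<ge> 3.3" using X2 \<tau>2 inv_sqrt_numeric C4 S by (simp add: k_def p_def)
        with C4 S show ?thesis by blast
      next
        assume S: "card S = 4"
        \<comment> \<open>The line at eight vertices is at most 2.921 + 0.82 = 3.741, so this case
          still lies above it, though narrowly.\<close>
        have "core_index > 3.75" using X2 \<tau>2 inv_sqrt_numeric C4 S by (simp add: k_def p_def)
        then have ?A using C4 S extremal_6_3(2) by simp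
        then show ?thesis by blast
      qed
      with k4 show ?thesis by blast
    qed
  qed
  then show "4 \<le> card C" "?A \<or> ?B \<or> ?D \<or> ?F" by blast+
qed

end

section \<open>Isomorphisms and the extremal graph\<close>

text \<open>Naming the bijection makes it possible to follow the attachment vertex to its image,
  which must be \<open>Hub\<close> when the deleted vertices are put back.\<close>

definition iso_map :: "('a \<Rightarrow> 'b) \<Rightarrow> 'a set \<Rightarrow> 'a set set \<Rightarrow> 'b set \<Rightarrow> 'b set set \<Rightarrow> bool" where
  "iso_map \<phi> V E W F \<longleftrightarrow> bij_betw \<phi> V W \<and> (\<forall>u\<in>V. \<forall>v\<in>V. {u, v} \<in> E \<longleftrightarrow> {\<phi> u, \<phi> v} \<in> F)"

lemma graph_isomorphic_iff: "graph_isomorphic V E W F \<longleftrightarrow> (\<exists>\<phi>. iso_map \<phi> V E W F)"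
  by (simp add: graph_isomorphic_def iso_map_def)

lemma iso_nbrs:
  assumes iso: "iso_map \<phi> V E W F" and sg: "simple_graph V E" "simple_graph W F" and v: "v \<in> V"
  shows "nbrs F (\<phi> v) = \<phi> ` nbrs E v"
proof (intro equalityI subsetI)
  have img: "\<phi> ` V = W" using iso by (simp add: iso_map_def bij_betw_def)
  fix w assume w: "w \<in> nbrs F (\<phi> v)"
  then have "w \<in> W" using simple_graph_nbrs(1)[OF sg(2)] by blast
  then obtain x where x: "x \<in> V" "w = \<phi> x" using img by blast
  then have "{v, x} \<in> E" using w iso v by (simp add: iso_map_def nbrs_def)
  then show "w \<in> \<phi> ` nbrs E v" using x by (auto simp: nbrs_def)
next
  fix w assume "w \<in> \<phi> ` nbrs E v"
  then obtain x where x: "x \<in> nbrs E v" "w = \<phi> x" by blast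
  moreover have "x \<in> V" using simple_graph_nbrs(1)[OF sg(1)] x(1) by blast
  ultimately show "w \<in> nbrs F (\<phi> v)" using iso v by (simp add: iso_map_def nbrs_def)
qed

lemma iso_degree:
  assumes iso: "iso_map \<phi> V E W F" and sg: "simple_graph V E" "simple_graph W F" and v: "v \<in> V"
  shows "degree F (\<phi> v) = degree E v"
proof -
  have "inj_on \<phi> (nbrs E v)"
    using iso simple_graph_nbrs(1)[OF sg(1)] by (auto simp: iso_map_def bij_betw_def intro: inj_on_subset)
  then show ?thesis
    unfolding degree_nbrs[OF sg(1)] degree_nbrs[OF sg(2)] iso_nbrs[OF assms] by (rule card_image)
qed

lemma iso_index:
  assumes iso: "iso_map \<phi> V E W F" and sg: "simple_graph V E" "simple_graph W F"
  shows "sum_connectivity_index F = sum_connectivity_index E"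
proof -
  have inj: "inj_on \<phi> V" and img: "\<phi> ` V = W" using iso by (auto simp: iso_map_def bij_betw_def)
  have edge: "\<exists>x y. e = {x, y} \<and> x \<noteq> y \<and> x \<in> U \<and> y \<in> U" if "simple_graph U D" "e \<in> D"
    for U :: "'c set" and D e
  proof -
    have "e \<subseteq> U" "card e = 2" using that by (auto simp: simple_graph_def)
    then show ?thesis by (auto simp: card_2_iff)
  qed
  have F: "F = (\<lambda>e. \<phi> ` e) ` E"
  proof (intro equalityI subsetI)
    fix e assume e: "e \<in> F"
    then obtain x y where "e = {\<phi> x, \<phi> y}" "x \<in> V" "y \<in> V"
      using edge[OF sg(2) e] img by blast
    moreover from this have "{x, y} \<in> E" using iso e by (simp add: iso_map_def)
    ultimately show "e \<in> (\<lambda>e. \<phi> ` e) ` E" by (intro image_eqI[of _ _ "{x, y}"]) auto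
  next
    fix e assume "e \<in> (\<lambda>e. \<phi> ` e) ` E"
    then obtain e' where e': "e = \<phi> ` e'" "e' \<in> E" by blast
    then obtain x y where "e' = {x, y}" "x \<in> V" "y \<in> V" using edge[OF sg(1) e'(2)] by blast
    then show "e \<in> F" using e' iso by (simp add: iso_map_def)
  qed
  have sub: "e \<subseteq> V" if "e \<in> E" for e using sg(1) that by (auto simp: simple_graph_def)
  have "inj_on (\<lambda>e. \<phi> ` e) E"
  proof (rule inj_onI)
    fix x y assume "x \<in> E" "y \<in> E" "\<phi> ` x = \<phi> ` y"
    then show "x = y" using inj_on_image_eq_iff[OF inj sub sub] by blast
  qed
  then have "sum_connectivity_index F = (\<Sum>e\<in>E. inv_sqrt (\<Sum>v\<in>\<phi> ` e. real (degree F v)))"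
    unfolding index_eq F by (simp add: sum.reindex)
  also have "\<dots> = (\<Sum>e\<in>E. inv_sqrt (\<Sum>v\<in>e. real (degree E v)))"
  proof (intro sum.cong refl arg_cong[where f = inv_sqrt])
    fix e assume "e \<in> E"
    then have e: "e \<subseteq> V" by (rule sub)
    then have "inj_on \<phi> e" using inj by (rule inj_on_subset[rotated])
    then have "(\<Sum>v\<in>\<phi> ` e. real (degree F v)) = (\<Sum>v\<in>e. real (degree F (\<phi> v)))"
      by (simp add: sum.reindex)
    also have "\<dots> = (\<Sum>v\<in>e. real (degree E v))"
      using e by (intro sum.cong refl) (simp add: iso_degree[OF assms] subset_iff)
    finally show "(\<Sum>v\<in>\<phi> ` e. real (degree F v)) = (\<Sum>v\<in>e. real (degree E v))" .
  qed
  finally show ?thesis by (simp add: index_eq)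
qed

text \<open>Undoes a deletion: an isomorphism of the smaller graphs extends by sending the restored
  pendent vertex to a fresh one joined to the image of its neighbour. A removed path is restored by
  two applications.\<close>

lemma iso_map_add_leaf:
  assumes iso: "iso_map \<phi> (V - {u}) (del E u) W F"
    and sg: "simple_graph V E" "simple_graph W F"
    and u: "degree E u = 1" "{u, v} \<in> E" and y: "y \<notin> W"
  shows "iso_map (\<phi>(u := y)) V E (insert y W) (insert {\<phi> v, y} F)"
proof -
  have uV: "u \<in> V" "v \<in> V - {u}" using sg(1) u(2) by (auto simp: simple_graph_def)
  have bij: "bij_betw \<phi> (V - {u}) W" using iso by (simp add: iso_map_def)
  then have inW: "\<phi> x \<in> W" if "x \<in> V - {u}" for x using that by (rule bij_betwE[rule_format])
  have inj: "\<phi> x = \<phi> z \<longleftrightarrow> x = z" if "x \<in> V - {u}" "z \<in> V - {u}" for x z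
    using bij that by (auto simp: bij_betw_def inj_on_def)
  have yF: "y \<notin> e" if "e \<in> F" for e using sg(2) y that by (auto simp: simple_graph_def)
  have single: "{x} \<notin> E" for x using sg(1) by (auto simp: simple_graph_def)
  have uE: "{u, b} \<in> E \<longleftrightarrow> b = v" for b
    using leaf_nbrs[OF sg(1) u] by (auto simp: nbrs_def)
  have "bij_betw (\<phi>(u := y)) (V - {u}) W"
    using bij by (subst bij_betw_cong[where g = \<phi>]) auto
  then have "bij_betw (\<phi>(u := y)) (V - {u} \<union> {u}) (W \<union> {y})"
    using y by (intro bij_betw_combine) (auto simp: bij_betw_def)
  moreover have "V - {u} \<union> {u} = V" "W \<union> {y} = insert y W" using uV(1) by auto
  ultimately have "bij_betw (\<phi>(u := y)) V (insert y W)" by simp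
  moreover have "{a, b} \<in> E \<longleftrightarrow> {(\<phi>(u := y)) a, (\<phi>(u := y)) b} \<in> insert {\<phi> v, y} F"
    if ab: "a \<in> V" "b \<in> V" for a b
  proof -
    have key: "{u, b} \<in> E \<longleftrightarrow> {y, \<phi> b} \<in> insert {\<phi> v, y} F" if "b \<in> V - {u}" for b
      using uE[of b] yF[of "{y, \<phi> b}"] inj[OF that uV(2)] inW[OF that] inW[OF uV(2)] y
      by (auto simp: doubleton_eq_iff)
    consider "a = u" "b = u" | "a = u" "b \<noteq> u" | "a \<noteq> u" "b = u" | "a \<noteq> u" "b \<noteq> u" by blast
    then show ?thesis
    proof cases
      \<comment> \<open>Isomorphism also quantifies over equal vertices, so the singleton has to be
        a non-edge on both sides.\<close>
      case 1
      then show ?thesis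
        using single[of u] yF[of "{y}"] inW[OF uV(2)] y by (auto simp: doubleton_eq_iff)
    next
      case 2
      then show ?thesis using key[of b] ab by simp
    next
      case 3
      then show ?thesis using key[of a] ab by (simp add: insert_commute)
    next
      case 4
      then have "{a, b} \<in> E \<longleftrightarrow> {a, b} \<in> del E u" by (auto simp: del_def)
      also have "\<dots> \<longleftrightarrow> {\<phi> a, \<phi> b} \<in> F" using iso ab 4 by (simp add: iso_map_def)
      also have "\<dots> \<longleftrightarrow> {\<phi> a, \<phi> b} \<in> insert {\<phi> v, y} F"
        using inW[of a] inW[of b] ab 4 y by (auto simp: doubleton_eq_iff)
      finally show ?thesis using 4 by simp
    qed
  qed
  ultimately show ?thesis by (simp add: iso_map_def)
qed

section \<open>The graph B_{n,m}: degrees, index and recursive construction\<close>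

lemma simple_graph_B: "simple_graph (B_vertices n m) (B_edges n m)"
proof -
  have "finite {Corner t b | t b. True}"
  proof -
    have "{Corner t b | t b. True} = (\<lambda>(t, b). Corner t b) ` UNIV" by auto
    then show ?thesis by simp
  qed
  then have "finite (B_vertices n m)" by (simp add: B_vertices_def)
  moreover have "e \<subseteq> B_vertices n m \<and> card e = 2" if "e \<in> B_edges n m" for e
    using that by (auto simp: B_vertices_def B_edges_def)
  ultimately show ?thesis
    by (simp add: simple_graph_def)
qed

lemma nbrs_B:
  "nbrs (B_edges n m) Hub = (\<lambda>(t, b). Corner t b) ` UNIV \<union> Pendent ` {..<n + 1 - 2 * m} \<union> Near ` {..<m - 3}"
  "nbrs (B_edges n m) (Corner t b) = {Hub, Corner t (\<not> b)}"
  "i < n + 1 - 2 * m \<Longrightarrow> nbrs (B_edges n m) (Pendent i) = {Hub}"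
  "i < m - 3 \<Longrightarrow> nbrs (B_edges n m) (Near i) = {Hub, Far i}"
  "i < m - 3 \<Longrightarrow> nbrs (B_edges n m) (Far i) = {Near i}"
  by (auto simp: nbrs_def B_edges_def doubleton_eq_iff image_iff)

lemma card_bool_pairs: "card (UNIV :: (bool \<times> bool) set) = 4"
  by (simp add: UNIV_Times_UNIV[symmetric] card_cartesian_product del: UNIV_Times_UNIV)

lemma degree_B:
  "degree (B_edges n m) Hub = 4 + (n + 1 - 2 * m) + (m - 3)"
  "degree (B_edges n m) (Corner t b) = 2"
  "i < n + 1 - 2 * m \<Longrightarrow> degree (B_edges n m) (Pendent i) = 1"
  "i < m - 3 \<Longrightarrow> degree (B_edges n m) (Near i) = 2"
  "i < m - 3 \<Longrightarrow> degree (B_edges n m) (Far i) = 1"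
proof -
  have "card ((\<lambda>(t, b). Corner t b) ` UNIV) = 4"
    by (subst card_image) (auto simp: inj_on_def card_bool_pairs)
  moreover have "card (Pendent ` {..<k}) = k" "card (Near ` {..<k}) = k" for k
    by (subst card_image; simp add: inj_on_def)+
  ultimately show "degree (B_edges n m) Hub = 4 + (n + 1 - 2 * m) + (m - 3)"
    unfolding degree_nbrs[OF simple_graph_B] nbrs_B
    by (subst card_Un_disjoint; (auto)[1])+
qed (simp_all add: degree_nbrs[OF simple_graph_B] nbrs_B)

lemma degree_B_le: "y \<in> B_vertices n m \<Longrightarrow> y \<noteq> Hub \<Longrightarrow> degree (B_edges n m) y \<le> 2"
  by (auto simp: B_vertices_def degree_B)

text \<open>The edges at \<open>Hub\<close> and those away from it are summed separately. The four
  corners and m-3 path vertices make up the m+1 equal summands, and the two triangle edges opposite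
  \<open>Hub\<close> give the final 1.\<close>

lemma index_B:
  assumes "3 \<le> m" "2 * m \<le> n"
  shows "sum_connectivity_index (B_edges n m) = extremal n m"
proof -
  let ?B = "B_edges n m" and ?p = "n + 1 - 2 * m" and ?q = "m - 3"
  let ?g = "\<lambda>e. inv_sqrt (\<Sum>v\<in>e. real (degree ?B v))"
  define D where "D = real n - real m + 2"
  have p: "real ?p = real n + 1 - 2 * real m" and q: "real ?q = real m - 3"
    using assms by (simp_all add: of_nat_diff)
  have D: "real (degree ?B Hub) = D"
    unfolding degree_B(1) of_nat_add p q D_def by simp
  have del: "del ?B Hub = (\<lambda>t. {Corner t False, Corner t True}) ` UNIV \<union> (\<lambda>i. {Near i, Far i}) ` {..<?q}"
    by (auto simp: del_def B_edges_def)
  have "(\<Sum>e\<in>del ?B Hub. ?g e) = (\<Sum>e\<in>(\<lambda>t. {Corner t False, Corner t True}) ` UNIV. ?g e)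
      + (\<Sum>e\<in>(\<lambda>i. {Near i, Far i}) ` {..<?q}. ?g e)"
    unfolding del by (intro sum.union_disjoint) auto
  also have "(\<Sum>e\<in>(\<lambda>t. {Corner t False, Corner t True}) ` UNIV. ?g e) = (\<Sum>t\<in>UNIV. ?g {Corner t False, Corner t True})"
    by (subst sum.reindex) (auto simp: inj_on_def doubleton_eq_iff)
  also have "\<dots> = 1" by (simp add: degree_B inv_sqrt_4 UNIV_bool)
  also have "(\<Sum>e\<in>(\<lambda>i. {Near i, Far i}) ` {..<?q}. ?g e) = (\<Sum>i<?q. ?g {Near i, Far i})"
    by (subst sum.reindex) (auto simp: inj_on_def doubleton_eq_iff)
  also have "\<dots> = (\<Sum>i<?q. inv_sqrt 3)" by (intro sum.cong refl) (simp add: degree_B)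
  also have "\<dots> = real ?q * inv_sqrt 3" by simp
  finally have 1: "(\<Sum>e\<in>del ?B Hub. ?g e) = 1 + real ?q * inv_sqrt 3" .
  have "(\<Sum>w\<in>nbrs ?B Hub. ?g {Hub, w}) = (\<Sum>w\<in>(\<lambda>(t, b). Corner t b) ` UNIV. ?g {Hub, w})
      + (\<Sum>w\<in>Pendent ` {..<?p}. ?g {Hub, w}) + (\<Sum>w\<in>Near ` {..<?q}. ?g {Hub, w})"
    unfolding nbrs_B by (subst sum.union_disjoint; (auto)[1])+
  also have "(\<Sum>w\<in>(\<lambda>(t, b). Corner t b) ` UNIV. ?g {Hub, w}) = (\<Sum>w\<in>(\<lambda>(t, b). Corner t b) ` (UNIV :: (bool \<times> bool) set). inv_sqrt (D + 2))"
    by (intro sum.cong refl) (auto simp: degree_B(2) D)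
  also have "\<dots> = 4 * inv_sqrt (D + 2)"
    by (subst sum.reindex) (auto simp: inj_on_def card_bool_pairs)
  also have "(\<Sum>w\<in>Pendent ` {..<?p}. ?g {Hub, w}) = (\<Sum>w\<in>Pendent ` {..<?p}. inv_sqrt (D + 1))"
    by (intro sum.cong refl) (auto simp: degree_B(3) D)
  also have "\<dots> = real ?p * inv_sqrt (D + 1)"
    by (subst sum.reindex) (auto simp: inj_on_def)
  also have "(\<Sum>w\<in>Near ` {..<?q}. ?g {Hub, w}) = (\<Sum>w\<in>Near ` {..<?q}. inv_sqrt (D + 2))"
    by (intro sum.cong refl) (auto simp: degree_B(4) D)
  also have "\<dots> = real ?q * inv_sqrt (D + 2)"
    by (subst sum.reindex) (auto simp: inj_on_def)
  finally have 2: "(\<Sum>w\<in>nbrs ?B Hub. ?g {Hub, w}) = 4 * inv_sqrt (D + 2) + real ?p * inv_sqrt (D + 1) + real ?q * inv_sqrt (D + 2)" .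
  show ?thesis
    unfolding index_eq sum_edges_split[OF simple_graph_B, of _ _ _ Hub] 1 2 p q extremal_def D_def
    by (simp add: algebra_simps)
qed

text \<open>The hypothesis admits n = 5, m = 3, outside the range of the theorem: there the graph is
  just the two triangles, from which B_{6,3} arises by adding a pendent vertex.\<close>

lemma B_add_pendent:
  assumes "2 * m \<le> n + 1"
  shows "B_vertices (n + 1) m = insert (Pendent (n + 1 - 2 * m)) (B_vertices n m)"
    and "B_edges (n + 1) m = insert {Hub, Pendent (n + 1 - 2 * m)} (B_edges n m)"
    and "Pendent (n + 1 - 2 * m) \<notin> B_vertices n m"
proof -
  define k where "k = n + 1 - 2 * m"
  have k: "n + 1 + 1 - 2 * m = Suc k" "n + 1 - 2 * m = k" using assms by (auto simp: k_def)
  show "B_vertices (n + 1) m = insert (Pendent (n + 1 - 2 * m)) (B_vertices n m)"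
    unfolding B_vertices_def k by (auto simp: less_Suc_eq)
  show "B_edges (n + 1) m = insert {Hub, Pendent (n + 1 - 2 * m)} (B_edges n m)"
    unfolding B_edges_def k by (auto simp: less_Suc_eq)
  show "Pendent (n + 1 - 2 * m) \<notin> B_vertices n m" by (auto simp: B_vertices_def)
qed

lemma B_add_path:
  assumes "3 \<le> m" "2 * m \<le> n"
  shows "B_vertices (n + 2) (m + 1) = insert (Far (m - 3)) (insert (Near (m - 3)) (B_vertices n m))"
    and "B_edges (n + 2) (m + 1) =
      insert {Near (m - 3), Far (m - 3)} (insert {Hub, Near (m - 3)} (B_edges n m))"
    and "Near (m - 3) \<notin> B_vertices n m" "Far (m - 3) \<notin> insert (Near (m - 3)) (B_vertices n m)"
proof -
  define k where "k = m - 3"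
  have k: "m + 1 - 3 = Suc k" "m - 3 = k" "n + 2 + 1 - 2 * (m + 1) = n + 1 - 2 * m"
    using assms by (auto simp: k_def)
  show "B_vertices (n + 2) (m + 1) = insert (Far (m - 3)) (insert (Near (m - 3)) (B_vertices n m))"
    unfolding B_vertices_def k by (auto simp: less_Suc_eq)
  show "B_edges (n + 2) (m + 1) =
      insert {Near (m - 3), Far (m - 3)} (insert {Hub, Near (m - 3)} (B_edges n m))"
    unfolding B_edges_def k by (auto simp: less_Suc_eq)
  show "Near (m - 3) \<notin> B_vertices n m" "Far (m - 3) \<notin> insert (Near (m - 3)) (B_vertices n m)"
    by (auto simp: B_vertices_def)
qed

text \<open>\<open>Hub\<close> is the only vertex of degree above two, so a degree condition
  identifies the image of the attachment vertex under any isomorphism.\<close>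

lemma hub_unique:
  assumes "iso_map \<phi> V E (B_vertices n m) (B_edges n m)" "simple_graph V E" "v \<in> V" "3 \<le> degree E v"
  shows "\<phi> v = Hub"
proof (rule ccontr)
  assume "\<phi> v \<noteq> Hub"
  moreover have "\<phi> v \<in> B_vertices n m" using assms(1,3) by (auto simp: iso_map_def bij_betw_def)
  ultimately have "degree (B_edges n m) (\<phi> v) \<le> 2" by (intro degree_B_le)
  then show False using iso_degree[OF assms(1,2) simple_graph_B assms(3)] assms(4) by simp
qed

text \<open>The vertex \<open>c\<close> is adjacent to the other four. Deleting it leaves each of
  them with degree one, hence two disjoint edges, which close the two triangles.\<close>

lemma butterfly:
  assumes sg: "simple_graph C H" and card: "card C = 5" "card H = 6" and c: "c \<in> C" "degree H c = 4"
    and two: "\<And>v. v \<in> C - {c} \<Longrightarrow> degree H v = 2"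
  obtains \<phi> where "iso_map \<phi> C H (B_vertices 5 3) (B_edges 5 3)" "\<phi> c = Hub"
proof -
  let ?D = "del H c"
  have fin: "finite C" "finite H" using simple_graph_finite[OF sg] by auto
  have sgD: "simple_graph (C - {c}) ?D" by (rule simple_graph_del[OF sg])
  have N: "nbrs H c = C - {c}"
  proof (rule card_subset_eq)
    show "nbrs H c \<subseteq> C - {c}" using simple_graph_nbrs(1,2)[OF sg, of c] by auto
    show "card (nbrs H c) = card (C - {c})"
      using degree_nbrs[OF sg, of c] c card(1) fin by simp
  qed (use fin in simp)
  have degD: "degree ?D v = 1" if "v \<in> C - {c}" for v
    using degree_del[OF sg, of v c] two[OF that] that N nbrs_sym[of c H v] by auto
  have "card ?D = 2" using card_del[OF sg, of c] card(2) c(2) by simp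
  then obtain d e where de: "?D = {d, e}" "d \<noteq> e" by (auto simp: card_2_iff)
  have sub: "d \<subseteq> C - {c}" "e \<subseteq> C - {c}" "card d = 2" "card e = 2"
    using sgD de(1) by (auto simp: simple_graph_def)
  have disj: "d \<inter> e = {}"
  proof (rule ccontr)
    assume "d \<inter> e \<noteq> {}"
    then obtain v where v: "v \<in> d" "v \<in> e" by blast
    then have "{h \<in> ?D. v \<in> h} = {d, e}" unfolding de(1) by auto
    then have "degree ?D v = 2" using de(2) by (simp add: degree_def)
    with degD[of v] v sub show False by auto
  qed
  obtain p q r t where pq: "d = {p, q}" "p \<noteq> q" and rt: "e = {r, t}" "r \<noteq> t"
    using sub(3,4) by (auto simp: card_2_iff)
  have dist: "distinct [c, p, q, r, t]" using pq rt disj sub by auto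
  then have neq: "c \<noteq> p" "c \<noteq> q" "c \<noteq> r" "c \<noteq> t" "p \<noteq> c" "p \<noteq> q" "p \<noteq> r" "p \<noteq> t" "q \<noteq> c" "q \<noteq> p" "q \<noteq> r" "q \<noteq> t" "r \<noteq> c" "r \<noteq> p" "r \<noteq> q" "r \<noteq> t" "t \<noteq> c" "t \<noteq> p" "t \<noteq> q" "t \<noteq> r"
    by auto
  have C: "C = {c, p, q, r, t}"
  proof (rule card_subset_eq[symmetric])
    show "{c, p, q, r, t} \<subseteq> C" using sub pq rt c by auto
    show "card {c, p, q, r, t} = card C" using dist card(1) by simp
  qed (rule fin)
  have "H = {h \<in> H. c \<in> h} \<union> ?D" by (auto simp: del_def)
  also have "{h \<in> H. c \<in> h} = (\<lambda>w. {c, w}) ` {p, q, r, t}"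
    unfolding incident_eq[OF sg] N C using dist by auto
  finally have H: "H = {{c, p}, {c, q}, {c, r}, {c, t}, {p, q}, {r, t}}"
    unfolding de(1) pq rt by auto
  define \<phi> where "\<phi> = (\<lambda>_. Corner True True)(c := Hub, p := Corner False False,
      q := Corner False True, r := Corner True False)"
  have \<phi>: "\<phi> c = Hub" "\<phi> p = Corner False False" "\<phi> q = Corner False True"
      "\<phi> r = Corner True False" "\<phi> t = Corner True True"
    using dist by (auto simp: \<phi>_def)
  have BV: "B_vertices 5 3 = {Hub, Corner False False, Corner False True, Corner True False, Corner True True}"
    by (auto simp: B_vertices_def)
  have BE: "B_edges 5 3 = {{Hub, Corner False False}, {Hub, Corner False True}, {Hub, Corner True False},
      {Hub, Corner True True}, {Corner False False, Corner False True}, {Corner True False, Corner True True}}"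
  proof -
    have "{g t b | t b. True} = {g False False, g False True, g True False, g True True}"
      for g :: "bool \<Rightarrow> bool \<Rightarrow> B_vertex set"
      by (auto simp: ex_bool_eq)
    moreover have "{g t | t. True} = {g False, g True}" for g :: "bool \<Rightarrow> B_vertex set"
      by (auto simp: ex_bool_eq)
    ultimately show ?thesis unfolding B_edges_def by auto
  qed
  have "iso_map \<phi> C H (B_vertices 5 3) (B_edges 5 3)"
    unfolding iso_map_def
  proof
    show "bij_betw \<phi> C (B_vertices 5 3)"
      unfolding bij_betw_def BV C using dist by (auto simp: \<phi> inj_on_def)
    show "\<forall>u\<in>C. \<forall>v\<in>C. ({u, v} \<in> H) = ({\<phi> u, \<phi> v} \<in> B_edges 5 3)"
      unfolding C H BE by (simp add: \<phi> neq doubleton_eq_iff)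
  qed
  with \<phi>(1) that show thesis by blast
qed

section \<open>The lower bound\<close>

lemma bicyclic_degree_pos:
  assumes bi: "bicyclic V E" and v: "v \<in> V"
  shows "1 \<le> degree E v"
proof -
  have sg: "simple_graph V E" using bi by (simp add: bicyclic_def)
  have "0 < card E" using bi by (simp add: bicyclic_def)
  then have "E \<noteq> {}" by auto
  then obtain e where e: "e \<in> E" by blast
  have "\<not> e \<subseteq> {v}"
  proof
    assume "e \<subseteq> {v}"
    then have "card e \<le> 1" using card_mono[of "{v}" e] by simp
    with sg e show False by (auto simp: simple_graph_def)
  qed
  then obtain w where w: "w \<in> V" "w \<noteq> v" using sg e by (auto simp: simple_graph_def)
  then have "(v, w) \<in> {(x, y). {x, y} \<in> E}\<^sup>*"
    using bi v by (simp add: bicyclic_def connected_graph_def)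
  then show ?thesis
  proof (cases rule: converse_rtranclE)
    case base
    with w(2) show ?thesis by simp
  next
    case (step z)
    then have "z \<in> nbrs E v" by (simp add: nbrs_def)
    with sg show ?thesis by (rule degree_pos_nbr)
  qed
qed

lemma irreducible_bound:
  assumes bi: "bicyclic V E"
    and deg3: "\<And>u v. degree E u = 1 \<Longrightarrow> {u, v} \<in> E \<Longrightarrow> degree E v \<noteq> 2"
    and crit: "\<And>u. degree E u = 1 \<Longrightarrow> matching_number (del E u) \<noteq> matching_number E"
  shows "extremal (card V) (matching_number E) \<le> sum_connectivity_index E \<and>
    (sum_connectivity_index E = extremal (card V) (matching_number E) \<longrightarrow> 3 \<le> matching_number E \<and>
      graph_isomorphic V E (B_vertices (card V) (matching_number E)) (B_edges (card V) (matching_number E)))"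
proof -
  have sg: "simple_graph V E" and cE: "card E = card V + 1" using bi by (auto simp: bicyclic_def)
  note fin = simple_graph_finite[OF sg]
  define P where "P = {u \<in> V. degree E u = 1}"
  define C where "C = V - P"
  define H where "H = {e \<in> E. e \<subseteq> C}"
  define S where "S = {v \<in> C. \<exists>u\<in>P. {u, v} \<in> E}"
  have finP: "finite P" "finite C" "finite S" using fin by (auto simp: P_def C_def S_def)
  have sgH: "simple_graph C H"
    using sg finP by (auto simp: simple_graph_def H_def)
  have one: "u = u'" if "u \<in> P" "u' \<in> P" "{u, v} \<in> E" "{u', v} \<in> E" for u u' v
  proof (rule ccontr)
    assume "u \<noteq> u'"
    moreover have "u \<in> nbrs E v" "u' \<in> nbrs E v" using that by (simp_all add: nbrs_def insert_commute)
    ultimately have "\<exists>x\<in>{u, u'}. matching_number (del E x) = matching_number E"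
      using that(1,2) by (intro matching_number_two_leaves[OF sg]) (auto simp: P_def)
    then show False using crit that(1,2) by (auto simp: P_def)
  qed
  define \<pi> where "\<pi> v = (SOME u. u \<in> P \<and> {u, v} \<in> E)" for v
  have \<pi>: "\<pi> v \<in> P" "{\<pi> v, v} \<in> E" if "v \<in> S" for v
  proof -
    have "\<exists>u. u \<in> P \<and> {u, v} \<in> E" using that by (auto simp: S_def)
    from someI_ex[OF this] show "\<pi> v \<in> P" "{\<pi> v, v} \<in> E" by (auto simp: \<pi>_def)
  qed
  \<comment> \<open>Degree three is what keeps the core at minimum degree two: a neighbour of a
    pendent vertex loses exactly that one vertex when all of them are stripped.\<close>
  have stem: "v \<in> S \<and> 3 \<le> degree E v \<and> u = \<pi> v" if "u \<in> P" "{u, v} \<in> E" for u v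
  proof -
    have u: "degree E u = 1" using that(1) by (simp add: P_def)
    have v: "v \<in> V" using sg that(2) by (auto simp: simple_graph_def)
    \<comment> \<open>An edge with two pendent ends would be the whole connected graph, whereas a
      bicyclic graph has more edges than vertices.\<close>
    have "degree E v \<noteq> 1"
    proof
      assume "degree E v = 1"
      have uv: "u \<noteq> v" using sg that(2) by (auto simp: simple_graph_def)
      have "{v, u} \<in> E" using that(2) by (simp add: insert_commute)
      then have Nv: "nbrs E v = {u}" using leaf_nbrs[OF sg \<open>degree E v = 1\<close>] by blast
      have Nu: "nbrs E u = {v}" by (rule leaf_nbrs[OF sg u that(2)])
      have reach: "y \<in> {u, v}" if "(u, y) \<in> {(x, y). {x, y} \<in> E}\<^sup>*" for y
        using that
      proof (induction rule: rtrancl_induct)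
        case (step y z)
        then have "z \<in> nbrs E y" by (simp add: nbrs_def)
        with step.IH Nu Nv show ?case by auto
      qed simp
      have uV: "u \<in> V" using that(1) by (simp add: P_def)
      have "V \<subseteq> {u, v}"
      proof
        fix y assume "y \<in> V"
        then have "(u, y) \<in> {(x, y). {x, y} \<in> E}\<^sup>*"
          using bi uV by (simp add: bicyclic_def connected_graph_def)
        then show "y \<in> {u, v}" by (rule reach)
      qed
      then have "E \<subseteq> {{u, v}}"
      proof (intro subsetI)
        fix e assume e: "e \<in> E"
        then have "e \<subseteq> {u, v}" "card e = 2" using sg \<open>V \<subseteq> {u, v}\<close> by (auto simp: simple_graph_def)
        then have "e = {u, v}" using uv by (intro card_subset_eq) auto
        then show "e \<in> {{u, v}}" by simp
      qed
      then have "card E \<le> 1" using card_mono[of "{{u, v}}" E] by simp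
      moreover have "2 \<le> card V" using card_mono[of V "{u, v}"] fin v uV uv by simp
      ultimately show False using cE by simp
    qed
    with bicyclic_degree_pos[OF bi v] deg3[OF u that(2)] have d: "3 \<le> degree E v" by linarith
    then have "v \<in> C" using v by (simp add: C_def P_def)
    then have vS: "v \<in> S" using that by (auto simp: S_def)
    with d one[OF that(1) \<pi>(1) that(2) \<pi>(2)] show ?thesis by simp
  qed
  have nbrs_P: "nbrs E v \<inter> P = (if v \<in> S then {\<pi> v} else {})" if "v \<in> C" for v
    using stem \<pi> by (auto simp: nbrs_def insert_commute)
  have deg: "degree E v = degree H v + (if v \<in> S then 1 else 0)" if v: "v \<in> C" for v
  proof -
    have "nbrs H v = nbrs E v - P"
      using simple_graph_nbrs(1)[OF sg, of v] v by (auto simp: nbrs_def H_def C_def)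
    moreover have "card (nbrs E v) = card (nbrs E v - P) + card (nbrs E v \<inter> P)"
      using simple_graph_nbrs(3)[OF sg, of v] by (subst card_Un_disjoint[symmetric]) (auto intro: arg_cong[where f = card])
    ultimately show ?thesis
      using nbrs_P[OF v] degree_nbrs[OF sg, of v] degree_nbrs[OF sgH, of v] by simp
  qed
  have inj: "inj_on (\<lambda>v. {\<pi> v, v}) S"
  proof (rule inj_onI)
    fix v w assume vw: "v \<in> S" "w \<in> S" "{\<pi> v, v} = {\<pi> w, w}"
    moreover have "v \<notin> P" "w \<notin> P" using vw by (auto simp: S_def C_def)
    ultimately show "v = w" using \<pi>(1) by (auto simp: doubleton_eq_iff)
  qed
  have PS: "card P = card S"
  proof -
    have "inj_on \<pi> S"
    proof (rule inj_onI)
      fix v w assume vw: "v \<in> S" "w \<in> S" "\<pi> v = \<pi> w"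
      have "degree E (\<pi> v) = 1" using \<pi>(1)[OF vw(1)] by (simp add: P_def)
      from leaf_nbrs[OF sg this \<pi>(2)[OF vw(1)]] \<pi>(2)[OF vw(2)] vw(3) show "v = w"
        by (auto simp: nbrs_def)
    qed
    moreover have "\<pi> ` S = P"
    proof (intro equalityI subsetI)
      fix u assume u: "u \<in> P"
      then obtain v where "{u, v} \<in> E" using leafE[OF sg, of u] by (auto simp: P_def)
      with stem[OF u this] show "u \<in> \<pi> ` S" by blast
    qed (use \<pi> in auto)
    ultimately show ?thesis by (metis card_image)
  qed
  have E_split: "E = H \<union> (\<lambda>v. {\<pi> v, v}) ` S"
  proof (intro equalityI subsetI)
    fix e assume e: "e \<in> E"
    show "e \<in> H \<union> (\<lambda>v. {\<pi> v, v}) ` S"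
    proof (cases "e \<inter> P = {}")
      case True
      have "e \<subseteq> V" using sg e by (auto simp: simple_graph_def)
      with True e show ?thesis by (auto simp: H_def C_def)
    next
      case False
      then obtain u where u: "u \<in> e" "u \<in> P" by blast
      then obtain v where v: "e = {u, v}" using simple_graph_edgeE[OF sg e u(1)] by metis
      with stem[of u v] e u show ?thesis by blast
    qed
  qed (use \<pi> in \<open>auto simp: H_def\<close>)
  have disj: "H \<inter> (\<lambda>v. {\<pi> v, v}) ` S = {}" using \<pi>(1) by (auto simp: H_def C_def)
  have finH: "finite H" using fin by (simp add: H_def)
  have cV: "card V = card C + card S"
  proof -
    have "card V = card (C \<union> P)" by (rule arg_cong[where f = card]) (auto simp: C_def P_def)
    also have "\<dots> = card C + card P" using finP by (intro card_Un_disjoint) (auto simp: C_def)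
    finally show ?thesis using PS by simp
  qed
  have cH: "card H = card C + 1"
  proof -
    have "card E = card (H \<union> (\<lambda>v. {\<pi> v, v}) ` S)" using E_split by (rule arg_cong)
    also have "\<dots> = card H + card ((\<lambda>v. {\<pi> v, v}) ` S)"
      using finH finP disj by (intro card_Un_disjoint) auto
    also have "card ((\<lambda>v. {\<pi> v, v}) ` S) = card S" using inj by (rule card_image)
    finally show ?thesis using cE cV by simp
  qed
  interpret core: core_graph C H S
  proof
    show "simple_graph C H" "card H = card C + 1" by fact+
    show "S \<subseteq> C" by (auto simp: S_def)
    fix v assume v: "v \<in> C"
    then have "v \<in> V" "degree E v \<noteq> 1" by (auto simp: C_def P_def)
    with bicyclic_degree_pos[OF bi this(1)] have "2 \<le> degree E v" by linarith
    moreover have "3 \<le> degree E v" if "v \<in> S" using stem[OF \<pi>[OF that]] by simp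
    ultimately show "2 \<le> degree H v" using deg[OF v] by (auto split: if_splits)
  qed
  have degE: "real (degree E v) = real (degree H v) + core.attached v" if "v \<in> C" for v
    using deg[OF that] by (simp add: core.attached_def)
  have index: "sum_connectivity_index E = core.core_index"
  proof -
    let ?F = "\<lambda>e. inv_sqrt (\<Sum>v\<in>e. real (degree E v))"
    have "sum_connectivity_index E = (\<Sum>e\<in>H \<union> (\<lambda>v. {\<pi> v, v}) ` S. ?F e)"
      unfolding index_eq by (rule arg_cong[OF E_split])
    also have "\<dots> = (\<Sum>e\<in>H. ?F e) + (\<Sum>e\<in>(\<lambda>v. {\<pi> v, v}) ` S. ?F e)"
      using finH finP disj by (intro sum.union_disjoint) auto
    also have "(\<Sum>e\<in>(\<lambda>v. {\<pi> v, v}) ` S. ?F e) = (\<Sum>v\<in>S. ?F {\<pi> v, v})"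
      by (subst sum.reindex[OF inj]) simp
    also have "\<dots> = (\<Sum>v\<in>S. inv_sqrt (real (degree H v) + 2))"
    proof (intro sum.cong refl)
      fix v assume v: "v \<in> S"
      then have vC: "v \<in> C" by (simp add: S_def)
      have "degree E (\<pi> v) = 1" "\<pi> v \<noteq> v" using \<pi>(1)[OF v] vC by (auto simp: P_def C_def)
      then show "?F {\<pi> v, v} = inv_sqrt (real (degree H v) + 2)"
        using degE[OF vC] v by (simp add: core.attached_def add_ac)
    qed
    also have "(\<Sum>e\<in>H. ?F e) = (\<Sum>e\<in>H. inv_sqrt (\<Sum>v\<in>e. real (degree H v) + core.attached v))"
    proof (rule sum.cong[OF refl])
      fix e assume "e \<in> H"
      then have "(\<Sum>v\<in>e. real (degree E v)) = (\<Sum>v\<in>e. real (degree H v) + core.attached v)"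
        using degE by (intro sum.cong refl) (auto simp: H_def)
      then show "?F e = inv_sqrt (\<Sum>v\<in>e. real (degree H v) + core.attached v)" by (rule arg_cong)
    qed
    finally show ?thesis by (simp add: core.core_index_def)
  qed
  define m where "m = matching_number E"
  have m: "2 * m \<le> card V" unfolding m_def by (rule matching_number_le[OF sg])
  have n4: "4 \<le> card V" using core.core_index_bound(1) cV by simp
  have lin: "extremal (card V) m \<le> extremal 6 3 + 0.41 * (real (card C + card S) - 6)"
    using extremal_linear[OF m n4] by (simp add: cV)
  consider (A) "core.core_index > extremal 6 3 + 0.41 * (real (card C + card S) - 6)"
    | (B) c where "c \<in> C" "card C = 5" "degree H c = 4" "S = {c}" "core.core_index \<ge> extremal 6 3"
    | (D) "card C = 4" "card S = 3" "core.core_index \<ge> 3.3"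
    | (F) x y where "card C = 4" "x \<noteq> y" "degree H x = 3" "degree H y = 3" "S = {x, y}" "core.core_index \<ge> 2.8"
    using core.core_index_bound(2) by blast
  then have "extremal (card V) m \<le> core.core_index \<and>
    (core.core_index = extremal (card V) m \<longrightarrow> 3 \<le> m \<and> graph_isomorphic V E (B_vertices (card V) m) (B_edges (card V) m))"
  proof cases
    case A
    then have "extremal (card V) m < core.core_index" using lin by linarith
    then show ?thesis by simp
  next
    case (D)
    then have "card V = 7" using cV by simp
    moreover from this have "extremal 7 m \<le> 3.2" using m by (intro extremal_7) simp
    then have "extremal 7 m < core.core_index" using D(3) by (simp add: field_simps)
    ultimately show ?thesis by simp
  next
    case (F x y)
    then have V6: "card V = 6" using cV by simp
    have xy: "x \<in> C" "y \<in> C" "x \<in> S" "y \<in> S" using F(5) core.S_sub by auto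
    then have "degree E x = 4" "degree E y = 4" using deg F(3,4) by simp_all
    \<comment> \<open>Both vertices have degree 4 and there are seven edges: 4 + 4 + m <= 7 +
      3.\<close>
    then have "m \<le> 2" using edge_matching_le[OF sg F(2)] cE V6 by (simp add: m_def)
    then have "extremal 6 m \<le> 2.7" by (rule extremal_6)
    then have "extremal 6 m < core.core_index" using F(6) by (simp add: field_simps)
    then show ?thesis using V6 by simp
  next
    case (B c)
    then have V6: "card V = 6" using cV by simp
    show ?thesis
    proof (cases "m \<le> 2")
      case True
      then have "extremal 6 m \<le> 2.7" by (rule extremal_6)
      then have "extremal 6 m < core.core_index" using B(5) extremal_6_3(1) by (simp add: field_simps)
      then show ?thesis using V6 by simp
    next
      case False
      then have m3: "m = 3" using m V6 by simp
      define u where "u = \<pi> c"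
      \<comment> \<open>The graph is two triangles sharing \<open>c\<close> with one pendent vertex
        at \<open>c\<close>, that is B_{6,3}; the isomorphism is built by deleting that vertex and
        restoring it.\<close>
      have u: "u \<in> P" "{u, c} \<in> E" using \<pi> B(4) by (auto simp: u_def)
      have "P = {u}" using u(1) PS B(4) finP by (auto simp: card_1_singleton_iff)
      then have CV: "C = V - {u}" by (simp add: C_def)
      have H: "H = del E u"
        using sg by (auto simp: H_def del_def CV simple_graph_def)
      have two: "degree H v = 2" if v: "v \<in> C - {c}" for v
      proof (cases rule: core.degree_cases)
        case (one c')
        then have "c = c'" using B(1,3) by (cases "c = c'") auto
        then show ?thesis using one(3) v by blast
      next
        case (two x y)
        then show ?thesis using B(1,3) by (cases "c \<in> {x, y}") auto
      qed
      have "card H = 6" using cH B(2) by simp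
      obtain \<phi> where \<phi>: "iso_map \<phi> C H (B_vertices 5 3) (B_edges 5 3)" "\<phi> c = Hub"
        using butterfly[OF sgH B(2) \<open>card H = 6\<close> B(1,3) two] .
      have u1: "degree E u = 1" using u(1) by (simp add: P_def)
      have le6: "2 * 3 \<le> 5 + (1 :: nat)" by simp
      have "iso_map (\<phi>(u := Pendent (5 + 1 - 2 * 3))) V E (B_vertices (5 + 1) 3) (B_edges (5 + 1) 3)"
        unfolding B_add_pendent(1,2)[OF le6] \<phi>(2)[symmetric]
        by (rule iso_map_add_leaf[OF \<phi>(1)[unfolded CV H] sg simple_graph_B u1 u(2) B_add_pendent(3)[OF le6]])
      then have "graph_isomorphic V E (B_vertices 6 3) (B_edges 6 3)"
        by (auto simp: graph_isomorphic_iff)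
      then show ?thesis using B(5) by (simp add: V6 m3)
    qed
  qed
  then show ?thesis unfolding m_def index .
qed

section \<open>The induction on the number of vertices\<close>

lemma pendants_card:
  assumes sg: "simple_graph V E" and u: "degree E u = 1" "{u, v} \<in> E"
  defines "r \<equiv> card {w \<in> nbrs E v - {u}. degree E w = 1}"
  shows "r + 1 \<le> degree E v" "r + 2 * matching_number E \<le> card V"
proof -
  let ?R = "{w \<in> nbrs E v - {u}. degree E w = 1}"
  have fin: "finite (nbrs E v)" by (rule simple_graph_nbrs(3)[OF sg])
  have uN: "u \<in> nbrs E v" using u(2) by (simp add: nbrs_def insert_commute)
  \<comment> \<open>The deleted vertex is itself a pendent neighbour not counted by
    \<open>r\<close>, which accounts for the 1 in both bounds.\<close>
  have "{w \<in> nbrs E v. degree E w = 1} = insert u ?R" using uN u(1) by auto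
  then have "card {w \<in> nbrs E v. degree E w = 1} = r + 1" using fin by (simp add: r_def)
  then show "r + 2 * matching_number E \<le> card V" using pendants_matching_le[OF sg, of v] by simp
  have "card (insert u ?R) \<le> card (nbrs E v)" using fin uN by (intro card_mono) auto
  then show "r + 1 \<le> degree E v" using fin by (simp add: r_def degree_nbrs[OF sg])
qed

text \<open>The matching number is unrestricted, as both reductions may lead to graphs with m < 3.
  Equality is claimed to force m >= 3, so a tight smaller graph is always a genuine B_{n,m} and the
  truncated \<open>m - 3\<close> in its definition does no harm.\<close>

lemma bicyclic_bound:
  assumes "bicyclic V E"
  shows "extremal (card V) (matching_number E) \<le> sum_connectivity_index E \<and>
    (sum_connectivity_index E = extremal (card V) (matching_number E) \<longrightarrow> 3 \<le> matching_number E \<and>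
      graph_isomorphic V E (B_vertices (card V) (matching_number E)) (B_edges (card V) (matching_number E)))"
  using assms
proof (induction "card V" arbitrary: V E rule: less_induct)
  case less
  have bi: "bicyclic V E" by (rule less.prems)
  then have sg: "simple_graph V E" and cE: "card E = card V + 1" by (auto simp: bicyclic_def)
  consider (path) u x where "degree E u = 1" "{u, x} \<in> E" "degree E x = 2"
    | (pendent) u where "degree E u = 1" "matching_number (del E u) = matching_number E"
    | (core) "\<And>u v. degree E u = 1 \<Longrightarrow> {u, v} \<in> E \<Longrightarrow> degree E v \<noteq> 2"
        "\<And>u. degree E u = 1 \<Longrightarrow> matching_number (del E u) \<noteq> matching_number E"
    by blast
  then show ?case
  proof cases
    case core
    then show ?thesis by (rule irreducible_bound[OF bi])
  next
    case (pendent u)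
    define n m where "n = card (V - {u})" and "m = matching_number E"
    obtain v where v: "{u, v} \<in> E" "v \<noteq> u" "u \<in> V" "v \<in> V" using leafE[OF sg pendent(1)] .
    have bi': "bicyclic (V - {u}) (del E u)" and cV: "card V = n + 1"
      using bicyclic_leaf[OF bi pendent(1)] by (simp_all add: n_def)
    have sg': "simple_graph (V - {u}) (del E u)" using bi' by (simp add: bicyclic_def)
    have m': "matching_number (del E u) = m" using pendent(2) by (simp add: m_def)
    have mn: "2 * m \<le> n" using matching_number_le[OF sg'] m' by (simp add: n_def)
    then have mn': "2 * m \<le> n + 1" by simp
    have IH: "extremal n m \<le> sum_connectivity_index (del E u)"
      "sum_connectivity_index (del E u) = extremal n m \<Longrightarrow>
        3 \<le> m \<and> graph_isomorphic (V - {u}) (del E u) (B_vertices n m) (B_edges n m)"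
      using less.hyps[of "V - {u}" "del E u"] bi' cV by (auto simp: n_def[symmetric] m')
    define d r D where "d = degree E v" and "r = card {w \<in> nbrs E v - {u}. degree E w = 1}"
      and "D = n - m + 3"
    have r: "r + 1 \<le> d" "r \<le> n + 1 - 2 * m"
      using pendants_card[OF sg pendent(1) v(1)] cV by (auto simp: d_def r_def m_def)
    have d: "d \<le> D"
      using degree_matching_le[OF sg, of v] cE cV mn by (simp add: d_def D_def m_def)
    have ge: "sum_connectivity_index E \<ge> sum_connectivity_index (del E u) + leaf_gain d r + gap (real d + 1)"
      using index_leaf_ge[OF sg pendent(1) v(1)] by (simp add: d_def r_def)
    have step: "extremal (n + 1) m = extremal n m + leaf_gain D (real (n + 1 - 2 * m)) + gap (real D + 1)"
      using extremal_step1[OF mn] by (simp add: D_def add_ac)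
    have leaf_gain: "leaf_gain D (real (n + 1 - 2 * m)) \<le> leaf_gain d r"
      "d \<noteq> D \<Longrightarrow> leaf_gain D (real (n + 1 - 2 * m)) < leaf_gain d r"
      using leaf_gain_le[of d r "n + 1 - 2 * m" D] r d by auto
    have gap: "gap (real D + 1) \<le> gap (real d + 1)" using d by (intro gap_antimono) auto
    have "3 \<le> m \<and> graph_isomorphic V E (B_vertices (n + 1) m) (B_edges (n + 1) m)"
      if eq: "sum_connectivity_index E = extremal (n + 1) m"
    proof -
      \<comment> \<open>The strict form of the gain estimate rules out a smaller degree; tightness
        of the remaining estimates then makes the smaller graph extremal.\<close>
      have "d = D" using leaf_gain gap ge step IH(1) eq by fastforce
      have "sum_connectivity_index (del E u) = extremal n m" using leaf_gain(1) gap ge step IH(1) eq by linarith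
      from IH(2)[OF this] obtain \<phi> where m3: "3 \<le> m"
        and \<phi>: "iso_map \<phi> (V - {u}) (del E u) (B_vertices n m) (B_edges n m)"
        by (auto simp: graph_isomorphic_iff)
      have "u \<in> nbrs E v" using v(1) by (simp add: nbrs_def insert_commute)
      then have "degree (del E u) v = D - 1"
        using degree_del[OF sg v(2)] \<open>d = D\<close> by (simp add: d_def)
      then have hub: "\<phi> v = Hub"
        \<comment> \<open>In the smaller graph \<open>v\<close> has degree D - 1 = n - m + 2, well
          above two since 2m <= n and m >= 3.\<close>
        using mn m3 v by (intro hub_unique[OF \<phi> sg']) (auto simp: D_def)
      have "iso_map (\<phi>(u := Pendent (n + 1 - 2 * m))) V E (B_vertices (n + 1) m) (B_edges (n + 1) m)"
        unfolding B_add_pendent(1,2)[OF mn'] hub[symmetric]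
        by (rule iso_map_add_leaf[OF \<phi> sg simple_graph_B pendent(1) v(1) B_add_pendent(3)[OF mn']])
      then show ?thesis using m3 by (auto simp: graph_isomorphic_iff)
    qed
    moreover have "extremal (n + 1) m \<le> sum_connectivity_index E"
      using leaf_gain(1) gap ge step IH(1) by linarith
    ultimately show ?thesis unfolding cV m_def[symmetric] by blast
  next
    case (path u x)
    let ?V1 = "V - {u}" and ?E1 = "del E u"
    let ?V2 = "?V1 - {x}" and ?E2 = "del ?E1 x"
    define n m where "n = card ?V2" and "m = matching_number ?E2"
    have bi1: "bicyclic ?V1 ?E1" and cV1: "card V = card ?V1 + 1"
      using bicyclic_leaf[OF bi path(1)] .
    then have sg1: "simple_graph ?V1 ?E1" by (simp add: bicyclic_def)
    have xu: "x \<noteq> u" using sg path(2) by (auto simp: simple_graph_def)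
    have "u \<in> nbrs E x" using path(2) by (simp add: nbrs_def insert_commute)
    then have x1: "degree ?E1 x = 1" using degree_del[OF sg xu] path(3) by simp
    obtain w where w: "{x, w} \<in> ?E1" "w \<noteq> x" "x \<in> ?V1" "w \<in> ?V1" using leafE[OF sg1 x1] .
    have bi2: "bicyclic ?V2 ?E2" and cV2: "card ?V1 = n + 1"
      using bicyclic_leaf[OF bi1 x1] by (simp_all add: n_def)
    have sg2: "simple_graph ?V2 ?E2" using bi2 by (simp add: bicyclic_def)
    have cV: "card V = n + 2" using cV1 cV2 by simp
    have mE: "matching_number E = m + 1"
      using matching_number_leaf[OF sg path(1,2)] by (simp add: m_def)
    \<comment> \<open>The pendent neighbours of \<open>w\<close> are counted in the intermediate
      graph, whose matching number is only estimated from below by that of the final one.\<close>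
    have m1: "m \<le> matching_number ?E1"
      unfolding m_def using simple_graph_finite[OF sg1] by (intro matching_number_del_le) simp
    have mn: "2 * m \<le> n" using matching_number_le[OF sg2] by (simp add: n_def m_def)
    have IH: "extremal n m \<le> sum_connectivity_index ?E2"
      "sum_connectivity_index ?E2 = extremal n m \<Longrightarrow>
        3 \<le> m \<and> graph_isomorphic ?V2 ?E2 (B_vertices n m) (B_edges n m)"
      using less.hyps[of ?V2 ?E2] bi2 cV by (auto simp: n_def[symmetric] m_def[symmetric])
    define d r D where "d = degree ?E1 w" and "r = card {z \<in> nbrs ?E1 w - {x}. degree ?E1 z = 1}"
      and "D = n - m + 3"
    have r: "r + 1 \<le> d" "r \<le> n + 1 - 2 * m"
      using pendants_card[OF sg1 x1 w(1)] cV2 m1 by (auto simp: d_def r_def)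
    have Nu: "nbrs E u = {x}" by (rule leaf_nbrs[OF sg path(1,2)])
    have dw: "degree E w = d"
      using degree_del[OF sg, of w u] w nbrs_sym[of u E w] Nu by (simp add: d_def)
    have d: "d \<le> D"
      using degree_matching_le[OF sg, of w] cE cV mn mE by (simp add: dw D_def)
    have ge1: "sum_connectivity_index ?E1 \<ge> sum_connectivity_index ?E2 + leaf_gain d r + gap (real d + 1)"
      using index_leaf_ge[OF sg1 x1 w(1)] by (simp add: d_def r_def)
    have "nbrs E x - {u} = {w}"
      using leaf_nbrs[OF sg1 x1 w(1)] nbrs_del[OF xu, of E] by simp
    \<comment> \<open>Restoring \<open>u\<close> raises the degree of \<open>x\<close> from one to
      two, so the edge from \<open>x\<close> to \<open>w\<close> loses \<open>gap (d + 1)\<close>.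
      This cancels the gap in \<open>ge1\<close>.\<close>
    then have "sum_connectivity_index E = sum_connectivity_index ?E1 + inv_sqrt 3 + (inv_sqrt (real d + 2) - inv_sqrt (real d + 1))"
      using index_leaf[OF sg path(1,2)] path(3) dw by (simp add: add_ac)
    then have ge: "sum_connectivity_index E \<ge> sum_connectivity_index ?E2 + inv_sqrt 3 + leaf_gain d r"
      using ge1 by (simp add: gap_def add_ac)
    have step: "extremal (n + 2) (m + 1) = extremal n m + inv_sqrt 3 + leaf_gain D (real (n + 1 - 2 * m))"
      using extremal_step2[OF mn] by (simp add: D_def)
    have leaf_gain: "leaf_gain D (real (n + 1 - 2 * m)) \<le> leaf_gain d r"
      "d \<noteq> D \<Longrightarrow> leaf_gain D (real (n + 1 - 2 * m)) < leaf_gain d r"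
      using leaf_gain_le[of d r "n + 1 - 2 * m" D] r d by auto
    have "3 \<le> m + 1 \<and> graph_isomorphic V E (B_vertices (n + 2) (m + 1)) (B_edges (n + 2) (m + 1))"
      if eq: "sum_connectivity_index E = extremal (n + 2) (m + 1)"
    proof -
      have "d = D" using leaf_gain ge step IH(1) eq by fastforce
      have "sum_connectivity_index ?E2 = extremal n m" using leaf_gain(1) ge step IH(1) eq by linarith
      from IH(2)[OF this] obtain \<phi> where m3: "3 \<le> m"
        and \<phi>: "iso_map \<phi> ?V2 ?E2 (B_vertices n m) (B_edges n m)"
        by (auto simp: graph_isomorphic_iff)
      have "x \<in> nbrs ?E1 w" using w(1) by (simp add: nbrs_def insert_commute)
      then have "degree ?E2 w = D - 1"
        using degree_del[OF sg1 w(2)] \<open>d = D\<close> by (simp add: d_def)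
      then have hub: "\<phi> w = Hub"
        using mn m3 w by (intro hub_unique[OF \<phi> sg2]) (auto simp: D_def)
      note B = B_add_path[OF m3 mn]
      let ?\<phi>1 = "\<phi>(x := Near (m - 3))"
      let ?W1 = "insert (Near (m - 3)) (B_vertices n m)" and ?F1 = "insert {Hub, Near (m - 3)} (B_edges n m)"
      have \<phi>1: "iso_map ?\<phi>1 ?V1 ?E1 ?W1 ?F1"
        unfolding hub[symmetric]
        by (rule iso_map_add_leaf[OF \<phi> sg1 simple_graph_B x1 w(1) B(3)])
      have sgF: "simple_graph ?W1 ?F1"
        using simple_graph_B[of n m] B(3) by (auto simp: simple_graph_def B_vertices_def)
      have "?\<phi>1 x = Near (m - 3)" by simp
      then have "iso_map (?\<phi>1(u := Far (m - 3))) V E (B_vertices (n + 2) (m + 1)) (B_edges (n + 2) (m + 1))"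
        unfolding B(1,2) using iso_map_add_leaf[OF \<phi>1 sg sgF path(1,2) B(4)] by simp
      then show ?thesis using m3 by (auto simp: graph_isomorphic_iff)
    qed
    moreover have "extremal (n + 2) (m + 1) \<le> sum_connectivity_index E"
      using leaf_gain(1) ge step IH(1) by linarith
    ultimately show ?thesis unfolding cV mE by blast
  qed
qed

theorem theorem2:
  fixes n m :: nat and V :: "'a set" and E :: "'a set set"
  assumes "3 \<le> m" and "m \<le> n div 2"
    and "bicyclic V E" and "card V = n" and "matching_number E = m"
  defines "bound \<equiv> (real m + 1) / sqrt (real n - real m + 4)
      + (real n - 2 * real m + 1) / sqrt (real n - real m + 3)
      + (real m - 3) / sqrt 3 + 1"
  shows "sum_connectivity_index E \<ge> bound \<and>
    (sum_connectivity_index E = bound \<longleftrightarrow>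
      graph_isomorphic V E (B_vertices n m) (B_edges n m))"
proof -
  have bound: "bound = extremal n m" by (simp add: bound_def extremal_def inv_sqrt_def)
  have sg: "simple_graph V E" using assms(3) by (simp add: bicyclic_def)
  have "sum_connectivity_index E = extremal n m" if "graph_isomorphic V E (B_vertices n m) (B_edges n m)"
  proof -
    from that obtain \<phi> where "iso_map \<phi> V E (B_vertices n m) (B_edges n m)"
      by (auto simp: graph_isomorphic_iff)
    from iso_index[OF this sg simple_graph_B] index_B[of m n] assms(1,2) show ?thesis by simp
  qed
  then show ?thesis
    using bicyclic_bound[OF assms(3)] unfolding bound assms(4,5) by blast
qed

end
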